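(* Let $n \geq 2$ be an integer, let $r,s$ be nonnegative integers with $r + 2s = n$, and let $S$ be a finite set of primes. Then there exist infinitely many monic irreducible polynomials $P(x)$ of degree $n$ with integer coefficients having exactly $r$ real roots, such that $\Delta(P)$ is squarefree and not divisible by any of the primes in $S$. More precisely, there is a constant $c>0$ (depending on $n$ and $S$) such that for all $N$ the number of distinct squarefree discriminants $\Delta(P)$ of such polynomials lying in the range $[-N, N]$ is at least $cN^{1/(n-1)}$.
   Context: For a monic polynomial $P(x)$ of degree $n$ with integer coefficients, factored as $P(x) = (x-r_1)\cdots(x-r_n)$ over an algebraically closed field, the discriminant is the integer $\Delta(P) = \prod_{1 \leq i < j \leq n} (r_i - r_j)^2$.
   Formalization: The bound cN^{1/(n-1)} is proved for all sufficiently large N, not for all N: for small positive N (e.g. N=1, n=2) no such discriminant lies in [-N,N]. The constant c is chosen after r and s, of which there are finitely many for each n. *)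

theory Defs
  imports Complex_Main "HOL-Computational_Algebra.Computational_Algebra"
begin

definition complex_roots_list :: "int poly \<Rightarrow> complex list" where
  "complex_roots_list P = (SOME rs. length rs = degree P \<and>
      map_poly of_int P = prod_list (map (\<lambda>r. [:- r, 1:]) rs))"

definition discriminant_complex :: "int poly \<Rightarrow> complex" where
  "discriminant_complex P = (let rs = complex_roots_list P in
      \<Prod>i<length rs. \<Prod>j\<in>{i<..<length rs}. (rs ! i - rs ! j) ^ 2)"

text \<open>The discriminant as an integer (it is an integer for monic integer polynomials).\<close>
definition discriminant :: "int poly \<Rightarrow> int" where
  "discriminant P = (THE d. of_int d = discriminant_complex P)"

definition num_real_roots :: "int poly \<Rightarrow> nat" where
  "num_real_roots P = card {x :: real. poly (map_poly of_int P) x = 0}"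

end

theory Submission
  imports Defs "HOL-Number_Theory.Number_Theory" "Jordan_Normal_Form.Char_Poly"
begin

text \<open>
  Fix a monic integer polynomial \<open>Q\<close> of degree \<open>n\<close> whose derivative is
  \<open>(n x - (n - 1)) \<Prod> (x - c\<^sub>j)\<close> with integers \<open>c\<^sub>j\<close>, so all its critical points \<open>\<gamma>\<^sub>j\<close> are
  rational. For \<open>P(x) = T\<^sup>n Q(x / T) + b\<close> the discriminant is, up to sign, \<open>n\<^sup>n\<close> times the product
  of the critical values \<open>T\<^sup>n Q(\<gamma>\<^sub>j) + b\<close>, that is, a product of \<open>n - 1\<close> integral linear forms
  in \<open>b\<close>. An elementary sieve makes such a product squarefree for a positive proportion of the
  \<open>b\<close> of size \<open>T\<^sup>n\<close> in a suitable residue class. The differences of the forms are fixed multiples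
  of \<open>T\<^sup>n\<close>, so letting \<open>T\<close> run through the powers of a fixed \<open>q\<close> keeps the sieve uniform in \<open>T\<close>;
  the discriminants have size \<open>T\<close> to the power \<open>n (n - 1)\<close>, whence the exponent \<open>1 / (n - 1)\<close>.

  Choosing the \<open>\<gamma>\<^sub>j\<close> widely spaced makes the critical values of \<open>Q\<close> alternate in sign and grow in
  absolute value, so that the range of \<open>b / T\<^sup>n\<close> determines the number of real roots. Finally
  \<open>P \<equiv> x\<^sup>n + b\<close> modulo \<open>q\<close>; if \<open>-b\<close> is a primitive root modulo a prime \<open>l\<close> dividing \<open>q\<close>, then the
  norm of \<open>x\<close> modulo a factor of \<open>P\<close> forces every divisor of \<open>n\<close> that divides \<open>l - 1\<close> to
  divide the degree of that factor.
\<close>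

hide_const (open) up_ring.coeff up_ring.monom module.smult

section \<open>Factors of binomials modulo a prime\<close>

text \<open>The matrix of multiplication by \<open>g\<close> on \<open>\<int>[x] / (f)\<close> for monic \<open>f\<close>, where pseudo-division is
  division with remainder.\<close>

definition mulmat :: "int poly \<Rightarrow> int poly \<Rightarrow> int mat" where
  "mulmat f g = mat (degree f) (degree f) (\<lambda>(i, j). coeff (snd (pseudo_divmod (g * monom 1 j) f)) i)"

lemma pseudo_divmod_monic:
  fixes f g :: "int poly"
  assumes "lead_coeff f = 1" "degree f > 0"
  shows "f dvd g - snd (pseudo_divmod g f)" and "degree (snd (pseudo_divmod g f)) < degree f"
proof -
  have f0: "f \<noteq> 0" using assms by auto
  obtain q r where qr: "pseudo_divmod g f = (q, r)" by force
  from pseudo_divmod[OF f0 qr] assms have g: "g - r = f * q" and r: "degree r < degree f"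
    by auto
  show "f dvd g - snd (pseudo_divmod g f)" by (simp add: qr g)
  show "degree (snd (pseudo_divmod g f)) < degree f" by (simp add: qr r)
qed

lemma monic_dvd_degree_less:
  fixes f g :: "int poly"
  assumes "f dvd g" "degree g < degree f"
  shows "g = 0"
  using assms by (meson dvd_imp_degree_le not_le)

lemma pseudo_rem_unique:
  fixes f g h :: "int poly"
  assumes "lead_coeff f = 1" "degree h < degree f" "f dvd g - h"
  shows "snd (pseudo_divmod g f) = h"
proof -
  let ?r = "snd (pseudo_divmod g f)"
  have d: "degree f > 0" using assms by linarith
  have "f dvd (g - h) - (g - ?r)"
    using assms pseudo_divmod_monic[OF assms(1) d] dvd_diff by blast
  hence "f dvd ?r - h" by simp
  moreover have "degree (?r - h) < degree f"
    using pseudo_divmod_monic(2)[OF assms(1) d] assms(2) degree_diff_less by blast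
  ultimately show ?thesis using monic_dvd_degree_less by fastforce
qed

lemma mulmat_carrier [simp]: "mulmat f g \<in> carrier_mat (degree f) (degree f)"
  by (simp add: mulmat_def)

lemma mulmat_cong:
  assumes "lead_coeff f = 1" "degree f > 0" "f dvd g - h"
  shows "mulmat f g = mulmat f h"
proof -
  have "snd (pseudo_divmod (g * monom 1 j) f) = snd (pseudo_divmod (h * monom 1 j) f)" for j
  proof (rule pseudo_rem_unique[OF assms(1) pseudo_divmod_monic(2)[OF assms(1,2)]])
    have "f dvd (g - h) * monom 1 j + (h * monom 1 j - snd (pseudo_divmod (h * monom 1 j) f))"
      using assms pseudo_divmod_monic(1)[OF assms(1,2)] by (intro dvd_add dvd_mult2) auto
    thus "f dvd g * monom 1 j - snd (pseudo_divmod (h * monom 1 j) f)"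
      by (simp add: algebra_simps)
  qed
  thus ?thesis by (simp add: mulmat_def)
qed

lemma mulmat_mult:
  assumes "lead_coeff f = 1" "degree f > 0"
  shows "mulmat f (g * h) = mulmat f g * mulmat f h"
proof (rule eq_matI)
  let ?d = "degree f"
  let ?r = "\<lambda>g. snd (pseudo_divmod g f)"
  fix i j assume "i < dim_row (mulmat f g * mulmat f h)" "j < dim_col (mulmat f g * mulmat f h)"
  hence ij: "i < ?d" "j < ?d" by (auto simp: mulmat_def)
  note r = pseudo_divmod_monic[OF assms]
  let ?w = "?r (h * monom 1 j)"
  \<comment> \<open>\<open>?s\<close> is column \<open>j\<close> of the matrix product: the
    remainder \<open>?w\<close> of \<open>h * monom 1 j\<close> is expanded in powers of x, and each
    power is multiplied by \<open>g\<close> and reduced again.\<close>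
  let ?s = "\<Sum>k<?d. smult (coeff ?w k) (?r (g * monom 1 k))"
  have w: "?w = (\<Sum>k<?d. monom (coeff ?w k) k)"
    using r(2)[of "h * monom 1 j"]
    by (intro poly_eqI) (auto simp: coeff_sum coeff_eq_0 intro!: sum.neutral)
  have dv: "f dvd (\<Sum>k<?d. smult (coeff ?w k) (g * monom 1 k - ?r (g * monom 1 k)))"
    by (intro dvd_sum dvd_smult r)
  have "g * ?w = (\<Sum>k<?d. smult (coeff ?w k) (g * monom 1 k))"
    by (subst w) (simp add: sum_distrib_left smult_monom flip: mult_smult_right)
  with dv have dv: "f dvd g * ?w - ?s"
    by (simp add: smult_diff_right sum_subtractf)
  have "f dvd g * (h * monom 1 j - ?w) + (g * ?w - ?s)"
    by (intro dvd_add dv dvd_mult r)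
  hence "f dvd g * h * monom 1 j - ?s" by (simp add: algebra_simps)
  moreover have "degree ?s < ?d"
    by (rule degree_sum_less) (use assms r(2) in \<open>auto intro: le_less_trans[OF degree_smult_le]\<close>)
  ultimately have "?r (g * h * monom 1 j) = ?s"
    by (intro pseudo_rem_unique assms)
  thus "mulmat f (g * h) $$ (i, j) = (mulmat f g * mulmat f h) $$ (i, j)"
    using ij by (simp add: mulmat_def scalar_prod_def coeff_sum mult.commute atLeast0LessThan)
qed (auto simp: mulmat_def)

lemma det_cong_mod:
  fixes A B :: "int mat"
  assumes "A \<in> carrier_mat d d" "B \<in> carrier_mat d d"
    and "\<And>i j. i < d \<Longrightarrow> j < d \<Longrightarrow> [A $$ (i, j) = B $$ (i, j)] (mod m)"
  shows "[det A = det B] (mod m)"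
  using assms unfolding det_def
  by (auto intro!: cong_sum cong_mult cong_prod simp: permutes_in_image)

text \<open>\<open>N\<close> is the norm of \<open>x\<close>: as \<open>x\<^sup>n\<close> acts on \<open>\<int>[x] / (f)\<close> like the scalar \<open>c\<close> modulo \<open>l\<close>, so do their
  determinants.\<close>

lemma norm_power_cong:
  fixes f g h :: "int poly" and c l :: int
  assumes mf: "lead_coeff f = 1"
    and fac: "f * g = monom 1 n - [:c:] + smult l h"
  shows "\<exists>N::int. [N ^ n = c ^ degree f] (mod l)"
proof (cases "degree f > 0")
  case False
  thus ?thesis by (intro exI[of _ 1]) auto
next
  case True
  let ?d = "degree f" and ?M = "mulmat f"
  \<comment> \<open>Multiplicativity of the determinant turns the norm of x^k into the k-th power of
    the norm of x.\<close>
  have pw: "det (?M (monom 1 k)) = det (?M (monom 1 1)) ^ k" for k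
  proof (induction k)
    case 0
    have "?M (monom 1 0) = 1\<^sub>m ?d"
    proof (rule eq_matI)
      fix i j assume "i < dim_row (1\<^sub>m ?d :: int mat)" "j < dim_col (1\<^sub>m ?d :: int mat)"
      moreover from this have "snd (pseudo_divmod (monom 1 j) f) = monom 1 j"
        by (intro pseudo_rem_unique mf) (auto simp: degree_monom_eq)
      ultimately show "?M (monom 1 0) $$ (i, j) = 1\<^sub>m ?d $$ (i, j)"
        by (auto simp: mulmat_def)
    qed (auto simp: mulmat_def)
    thus ?case by simp
  next
    case (Suc k)
    have "monom (1::int) (Suc k) = monom 1 1 * monom 1 k" by (simp add: mult_monom)
    hence "?M (monom 1 (Suc k)) = ?M (monom 1 1) * ?M (monom 1 k)"
      by (simp only: mulmat_mult[OF mf True])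
    thus ?case by (simp add: det_mult[of _ ?d] Suc)
  qed
  \<comment> \<open>By \<open>fac\<close>, x^n and c - l h differ by the multiple f g of
    \<open>f\<close>.\<close>
  have "?M (monom 1 n) = ?M ([:c:] - smult l h)"
    by (rule mulmat_cong[OF mf True])
      (use fac in \<open>metis (no_types, lifting) add_diff_eq diff_add_eq diff_diff_eq2 dvd_triv_left\<close>)
  moreover have "[det (?M ([:c:] - smult l h)) = det (c \<cdot>\<^sub>m 1\<^sub>m ?d)] (mod l)"
  proof (rule det_cong_mod[where d = ?d])
    fix i j assume ij: "i < ?d" "j < ?d"
    let ?r = "snd (pseudo_divmod (h * monom 1 j) f)"
    have "snd (pseudo_divmod (([:c:] - smult l h) * monom 1 j) f) = monom c j - smult l ?r"
    proof (rule pseudo_rem_unique[OF mf])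
      show "degree (monom c j - smult l ?r) < ?d"
        using ij pseudo_divmod_monic(2)[OF mf True]
        by (intro degree_diff_less) (auto intro: le_less_trans[OF degree_smult_le] le_less_trans[OF degree_monom_le])
      have "f dvd smult (-l) (h * monom 1 j - ?r)"
        using pseudo_divmod_monic(1)[OF mf True] by (rule dvd_smult)
      thus "f dvd ([:c:] - smult l h) * monom 1 j - (monom c j - smult l ?r)"
        by (simp add: algebra_simps smult_monom smult_diff_right)
    qed
    thus "[?M ([:c:] - smult l h) $$ (i, j) = (c \<cdot>\<^sub>m 1\<^sub>m ?d) $$ (i, j)] (mod l)"
      using ij by (auto simp: mulmat_def cong_iff_dvd_diff)
  qed auto
  ultimately show ?thesis
    by (intro exI[of _ "det (?M (monom 1 1))"]) (simp add: det_smult del: One_nat_def flip: pw)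
qed

text \<open>For positive \<open>n\<close> the norm \<open>N\<close> is a unit modulo
  \<open>l\<close>, hence a power \<open>c ^ m\<close> of the primitive root. Comparing exponents of
  \<open>c\<close> gives m n = degree f modulo l - 1, hence modulo \<open>k\<close>, and
  \<open>k\<close> divides \<open>n\<close>.\<close>

lemma dvd_degree_of_factor:
  fixes f g h :: "int poly" and l :: nat
  assumes mf: "lead_coeff f = 1"
    and fac: "f * g = monom 1 n - [:int c:] + smult (int l) h"
    and l: "prime l" and c: "residue_primroot l c" and k: "k dvd n" "k dvd l - 1"
  shows "k dvd degree f"
proof -
  obtain N where N: "[N ^ n = int c ^ degree f] (mod int l)"
    using norm_power_cong[OF mf fac] by blast
  define N' where "N' = nat (N mod int l)"
  have l1: "l > 1" using l prime_gt_1_nat by blast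
  have N': "int N' = N mod int l" using l1 by (simp add: N'_def)
  have "[int N' ^ n = int c ^ degree f] (mod int l)"
    using N unfolding N' cong_def by (simp add: power_mod)
  hence N1: "[N' ^ n = c ^ degree f] (mod l)"
    by (metis cong_int_iff of_nat_power)
  have cop: "coprime l c" using c by (auto simp: residue_primroot_def)
  show ?thesis
  proof (cases "n = 0")
    case True
    \<comment> \<open>For \<open>n = 0\<close> the norm may fail to be a unit, but the congruence
      itself reads \<open>c ^ degree f = 1\<close>, so the order l - 1 divides the degree.\<close>
    have "ord l c = l - 1" using c l by (simp add: residue_primroot_def totient_prime)
    moreover from True N1 have "[c ^ degree f = 1] (mod l)" by (simp add: cong_sym)
    ultimately show ?thesis using k by (metis dvd_trans ord_divides)
  next
    case False
    have "coprime l (N' ^ n)"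
      using cong_imp_coprime[OF cong_sym[OF N1]] cop by (simp add: coprime_commute)
    hence copN: "coprime l N'" using False by simp
    have "int N' < int l" unfolding N' using l1 by (intro pos_mod_bound) auto
    hence lt: "N' < l" by simp
    moreover have "N' \<noteq> 0" using copN l1 by (intro notI) auto
    ultimately have "N' \<in> totatives l" using copN by (simp add: totatives_def coprime_commute)
    also have "totatives l = (\<lambda>i. c ^ i mod l) ` {..<totient l}"
      using residue_primroot_is_generator[OF l1 c] by (simp add: bij_betw_def)
    finally obtain m where m: "[c ^ m = N'] (mod l)" using lt by (auto simp: cong_def)
    have "[c ^ (m * n) = c ^ degree f] (mod l)"
      using cong_trans[OF cong_pow[OF m, of n] N1] by (simp add: power_mult)
    hence "[m * n = degree f] (mod ord l c)"
      using cop order_divides_expdiff by blast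
    moreover have "ord l c = l - 1" using c l by (simp add: residue_primroot_def totient_prime)
    ultimately have "[m * n = degree f] (mod k)" using k(2) by (simp add: cong_dvd_modulus_nat)
    thus ?thesis using k(1) cong_dvd_iff dvd_mult by blast
  qed
qed

section \<open>A criterion for irreducibility\<close>

text \<open>Take \<open>l\<close> dividing \<open>1 + y + \<dots> + y\<close> to the power \<open>p - 1\<close>, where \<open>y\<close> is \<open>n\<close> to the power
  \<open>p\<close> to the \<open>e - 1\<close>; then \<open>n\<close> has order exactly \<open>p\<^sup>e\<close> modulo \<open>l\<close>.\<close>

lemma exists_prime_cong_1_mod_prime_power:
  fixes n p e :: nat
  assumes p: "prime p" and pn: "p dvd n" and n: "n > 1" and e: "e > 0"
  shows "\<exists>l. prime l \<and> coprime l n \<and> p ^ e dvd l - 1"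
proof -
  define y where "y = n ^ (p ^ (e - 1))"
  define S where "S = (\<Sum>i<p. y ^ i)"
  have p1: "p > 1" using p prime_gt_1_nat by blast
  have ny: "n dvd y" unfolding y_def using p1 by (intro dvd_power) auto
  have "{..<p} = insert 0 {1..<p}" using p1 by auto
  hence S: "S = 1 + (\<Sum>i=1..<p. y ^ i)" by (simp add: S_def)
  have "S \<noteq> 1" using S p1 n by (auto simp: y_def)
  then obtain l where l: "prime l" "l dvd S" using prime_factor_nat by blast
  have "n dvd (\<Sum>i=1..<p. y ^ i)" using ny by (intro dvd_sum) (auto intro: dvd_trans)
  \<comment> \<open>\<open>S\<close> is 1 modulo \<open>n\<close>, so a common divisor of
    \<open>S\<close> and \<open>n\<close> divides 1.\<close>
  hence unit: "is_unit c" if "c dvd n" "c dvd S" for c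
    using that unfolding S by (metis dvd_add_left_iff dvd_trans)
  have "coprime S n" by (rule coprimeI) (rule unit)
  hence ln: "coprime l n" using l(2) by (rule coprime_divisors[OF _ dvd_refl, rotated])

  have "int y ^ p - 1 = (int y - 1) * int S"
    unfolding S_def by (simp add: power_diff_1_eq)
  hence "int l dvd int y ^ p - 1" using l(2) by (metis dvd_mult int_dvd_int_iff)
  hence 1: "[y ^ p = 1] (mod l)" 
    by (metis cong_iff_dvd_diff cong_int_iff of_nat_1 of_nat_power)
  have "p ^ (e - 1) * p = p ^ e" using e by (rule power_minus_mult)
  hence yp: "y ^ p = n ^ (p ^ e)" by (simp only: y_def flip: power_mult)
  \<comment> \<open>If y were 1 modulo \<open>l\<close>, then \<open>S\<close> would be p modulo
    \<open>l\<close>, forcing l = p, which divides \<open>n\<close>. Hence the order of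
    \<open>n\<close> divides p^e but not p^(e-1).\<close>
  have "\<not> [y = 1] (mod l)"
  proof
    assume "[y = 1] (mod l)"
    hence "[S = (\<Sum>i<p. 1 ^ i)] (mod l)" unfolding S_def by (intro cong_sum cong_pow)
    hence "l dvd p" using l(2) by (simp add: cong_dvd_iff)
    hence "l = p" using p l(1) primes_dvd_imp_eq by blast
    thus False using ln pn p1 by (metis coprime_absorb_left nat_dvd_1_iff_1 less_irrefl)
  qed
  hence "\<not> ord l n dvd p ^ (e - 1)" by (simp add: y_def del: One_nat_def flip: ord_divides)
  moreover have "ord l n dvd p ^ e" using 1 by (simp add: yp del: One_nat_def flip: ord_divides)
  then obtain i where i: "i \<le> e" "ord l n = p ^ i" using divides_primepow_nat[OF p] by blast
  moreover have "i \<le> e - 1 \<or> i = e" using i(1) e by linarith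
  ultimately have "ord l n = p ^ e" using le_imp_power_dvd[of i "e - 1" p] by auto
  moreover have "ord l n dvd l - 1" using order_divides_totient[of l n] ln l(1) by (simp add: totient_prime)
  ultimately show ?thesis using l ln by auto
qed

text \<open>Each prime power exactly dividing \<open>n\<close> divides the degree of any factor, so
  \<open>n\<close> itself does, and this degree is 0 or \<open>n\<close>. A factor of degree 0 is a
  unit because \<open>P\<close> is monic.\<close>

lemma irreducible_int_poly_of_primroots:
  fixes P :: "int poly"
  assumes mP: "lead_coeff P = 1" and dP: "degree P = n" and n: "n > 0"
    and loc: "\<And>p. prime p \<Longrightarrow> p dvd n \<Longrightarrow> \<exists>l c h. prime l \<and> residue_primroot l c \<and>
           p ^ multiplicity p n dvd l - 1 \<and> P = monom 1 n - [:int c:] + smult (int l) h"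
  shows "irreducible P"
proof (rule irreducibleI)
  show "P \<noteq> 0" using mP by auto
  show "\<not> P dvd 1" using dP n dvd_imp_degree_le[of P 1] by auto
  fix f g assume fg: "P = f * g"
  have lc: "lead_coeff f * lead_coeff g = 1" using mP fg by (simp add: lead_coeff_mult)
  \<comment> \<open>The leading coefficients of the factors are both 1 or both -1. Multiplying both
    factors by \<open>u\<close> makes \<open>f\<close> monic and keeps the product.\<close>
  define u where "u = lead_coeff f"
  have u2: "u * u = 1" using lc by (auto simp: u_def zmult_eq_1_iff)
  have u0: "u \<noteq> 0" using u2 by auto
  have 1: "lead_coeff (smult u f) = 1" using u2 u0 by (simp flip: u_def)
  have P: "smult u f * smult u g = P" using u2 fg by simp
  have nd: "n dvd degree f"
  proof (cases "degree f = 0")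
    case False
    show ?thesis
    proof (rule multiplicity_le_imp_dvd)
      fix p :: nat assume p: "prime p"
      show "multiplicity p n \<le> multiplicity p (degree f)"
      proof (cases "p dvd n")
        case True
        from loc[OF p True] obtain l c h where h: "prime l" "residue_primroot l c" 
           "p ^ multiplicity p n dvd l - 1" "P = monom 1 n - [:int c:] + smult (int l) h" by blast
        have "p ^ multiplicity p n dvd degree (smult u f)"
          by (rule dvd_degree_of_factor[OF 1 P[unfolded h(4)] h(1,2) multiplicity_dvd h(3)])
        thus ?thesis using False p u0 by (intro multiplicity_geI) (auto simp: prime_gt_0_nat dest: prime_gt_1_nat)
      qed (simp add: not_dvd_imp_multiplicity_0)
    qed (use n in auto)
  qed auto
  have fg0: "f \<noteq> 0" "g \<noteq> 0" using lc by auto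
  have ddeg: "degree f + degree g = n" using dP fg fg0 by (simp add: degree_mult_eq)
  have "f dvd 1" if "degree f = 0" "is_unit (lead_coeff f)" for f :: "int poly"
    using that by (auto elim!: degree_eq_zeroE simp: is_unit_const_poly_iff)
  moreover have "degree f = 0 \<or> degree g = 0"
    using nd ddeg n dvd_imp_le[of n "degree f"] by linarith
  moreover have "is_unit (lead_coeff f)" "is_unit (lead_coeff g)" using lc by (metis dvd_triv_left dvd_triv_right)+
  ultimately show "f dvd 1 \<or> g dvd 1" by blast
qed

section \<open>Discriminants and critical values\<close>

text \<open>The fundamental theorem of algebra supplies a factorization, so the choice operator in
  the definition does select one.\<close>

lemma complex_roots_list:
  assumes "lead_coeff P = 1"
  shows "length (complex_roots_list P) = degree P"
    and "map_poly of_int P = (\<Prod>r\<leftarrow>complex_roots_list P. [:- r, 1:])"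
proof -
  obtain rs :: "complex list" where "smult (lead_coeff (map_poly of_int P)) (\<Prod>r\<leftarrow>rs. [:- r, 1:]) = map_poly of_int P"
    and "length rs = degree (map_poly of_int P :: complex poly)"
    using fundamental_theorem_algebra_factorized by blast
  hence "length rs = degree P \<and> map_poly of_int P = (\<Prod>r\<leftarrow>rs. [:- r, 1:])"
    using assms by simp
  hence "length (complex_roots_list P) = degree P \<and>
         map_poly of_int P = (\<Prod>r\<leftarrow>complex_roots_list P. [:- r, 1:])"
    unfolding complex_roots_list_def by (rule someI)
  thus "length (complex_roots_list P) = degree P"
    and "map_poly of_int P = (\<Prod>r\<leftarrow>complex_roots_list P. [:- r, 1:])" by auto
qed

text \<open>Each unordered pair occurs twice among the ordered pairs, with differences of opposite
  sign, so every pair contributes one factor -1.\<close>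

lemma prod_pairs_square:
  fixes x :: "nat \<Rightarrow> 'a :: comm_ring_1"
  shows "(\<Prod>i<n. \<Prod>j\<in>{i<..<n}. (x i - x j) ^ 2) =
         (-1) ^ (\<Sum>i<n. card {i<..<n}) * (\<Prod>i<n. \<Prod>j\<in>{..<n} - {i}. x i - x j)"
proof -
  have "(\<Prod>i<n. \<Prod>j\<in>{i<..<n}. (x i - x j) ^ 2) =
        (\<Prod>i<n. \<Prod>j\<in>{i<..<n}. (-1) * ((x i - x j) * (x j - x i)))"
    by (intro prod.cong refl) (simp add: power2_eq_square algebra_simps)
  also have "\<dots> = (\<Prod>i<n. (-1) ^ card {i<..<n}) *
      ((\<Prod>i<n. \<Prod>j\<in>{i<..<n}. x i - x j) * (\<Prod>i<n. \<Prod>j\<in>{i<..<n}. x j - x i))"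
    by (simp only: prod.distrib prod_constant)
  also have "(\<Prod>i<n. \<Prod>j\<in>{i<..<n}. x j - x i) = (\<Prod>(i,j)\<in>(SIGMA i:{..<n}. {i<..<n}). x j - x i)"
    by (simp add: prod.Sigma)
  also have "\<dots> = (\<Prod>(j,i)\<in>(SIGMA j:{..<n}. {..<j}). x j - x i)"
    by (rule prod.reindex_bij_witness[of _ prod.swap prod.swap]) auto
  also have "\<dots> = (\<Prod>i<n. \<Prod>j<i. x i - x j)"
    by (simp add: prod.Sigma)
  also have "(\<Prod>i<n. \<Prod>j\<in>{i<..<n}. x i - x j) * (\<Prod>i<n. \<Prod>j<i. x i - x j) =
             (\<Prod>i<n. \<Prod>j\<in>{..<n} - {i}. x i - x j)"
    unfolding prod.distrib[symmetric]
  proof (rule prod.cong)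
    fix i assume "i \<in> {..<n}"
    hence "{..<n} - {i} = {i<..<n} \<union> {..<i}" by auto
    thus "(\<Prod>j\<in>{i<..<n}. x i - x j) * (\<Prod>j<i. x i - x j) = (\<Prod>j\<in>{..<n} - {i}. x i - x j)"
      by (simp add: prod.union_disjoint Int_def)
  qed auto
  finally show ?thesis by (simp add: power_sum)
qed

text \<open>The product of P' over the roots x_i is computed in two ways. By the product rule it is
  the product of x_i - x_j over ordered pairs. By the factorization of P' it is n^n times the
  product of all x_i - \<gamma>_j, which regroups into the values of P at the critical points. The
  integer \<open>D\<close> makes the definite description well defined.\<close>

lemma discriminant_eq_prod_critical_values:
  fixes P :: "int poly" and \<gamma> :: "'a \<Rightarrow> complex" and D :: int
  assumes lc: "lead_coeff P = 1" and deg: "degree P = n" and J: "finite J"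
    and der: "map_poly of_int (pderiv P) = smult (of_nat n) (\<Prod>j\<in>J. [:- \<gamma> j, 1:])"
    and D: "of_int D = of_nat n ^ n * (\<Prod>j\<in>J. poly (map_poly of_int P) (\<gamma> j))"
    and cJ: "card J = n - 1"
  shows "discriminant P = (-1) ^ (\<Sum>i<n. card {i<..<n}) * D"
proof -
  define rs where "rs = complex_roots_list P"
  have len: "length rs = n" using complex_roots_list(1)[OF lc] deg by (simp add: rs_def)
  define x where "x = (\<lambda>i. rs ! i)"
  have "map_poly of_int P = (\<Prod>r\<leftarrow>rs. [:- r, 1:])"
    using complex_roots_list(2)[OF lc] by (simp add: rs_def)
  also have "rs = map x [0..<n]" by (simp add: x_def map_nth flip: len)
  finally have P: "map_poly of_int P = (\<Prod>i<n. [:- x i, 1:])"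
    by (simp add: comp_def atLeast0LessThan flip: prod.distinct_set_conv_list)
  have "poly (pderiv (\<Prod>i<n. [:- x i, 1:])) (x i) = (\<Prod>j\<in>{..<n} - {i}. x i - x j)" if i: "i < n" for i
  proof -
    have "poly (pderiv (\<Prod>i<n. [:- x i, 1:])) (x i) = (\<Sum>a<n. \<Prod>j\<in>{..<n} - {a}. x i - x j)"
      by (simp add: pderiv_prod poly_sum poly_prod pderiv_pCons)
    \<comment> \<open>At \<open>x i\<close> only the term that omits the factor of index
      \<open>i\<close> survives.\<close>
    also have "\<dots> = (\<Sum>a\<in>{i}. \<Prod>j\<in>{..<n} - {a}. x i - x j)"
      using i by (intro sum.mono_neutral_right) (auto intro!: prod_zero)
    finally show ?thesis by simp
  qed
  hence "(\<Prod>i<n. \<Prod>j\<in>{..<n} - {i}. x i - x j) =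
         (\<Prod>i<n. poly (map_poly of_int (pderiv P)) (x i))"
    by (intro prod.cong) (auto simp: of_int_hom.map_poly_pderiv P)
  also have "\<dots> = of_nat n ^ n * (\<Prod>i<n. \<Prod>j\<in>J. x i - \<gamma> j)"
    by (simp add: der poly_prod prod.distrib)
  also have "(\<Prod>i<n. \<Prod>j\<in>J. x i - \<gamma> j) = (\<Prod>j\<in>J. \<Prod>i<n. - 1 * (\<gamma> j - x i))"
    by (subst prod.swap) simp
  also have "\<dots> = (-1) ^ (n * (n - 1)) * (\<Prod>j\<in>J. \<Prod>i<n. \<gamma> j - x i)"
    by (simp only: prod.distrib prod_constant cJ card_lessThan power_mult)
  also have "(-1 :: complex) ^ (n * (n - 1)) = 1" by (cases "even n") auto
  also have "1 * (\<Prod>j\<in>J. \<Prod>i<n. \<gamma> j - x i) = (\<Prod>j\<in>J. poly (map_poly of_int P) (\<gamma> j))"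
    by (simp add: P poly_prod)
  also note D[symmetric]
  finally have "(\<Prod>i<n. \<Prod>j\<in>{..<n} - {i}. x i - x j) = of_int D" .
  hence "discriminant_complex P = of_int ((-1) ^ (\<Sum>i<n. card {i<..<n}) * D)"
    unfolding discriminant_complex_def Let_def rs_def[symmetric] len
    by (subst prod_pairs_square) (simp add: x_def)
  thus ?thesis unfolding discriminant_def by (intro the_equality) (auto simp del: of_int_mult)
qed

section \<open>Counting real roots from critical values\<close>

text \<open>A value \<le> 0 inside would force, by the mean value theorem, a negative slope before
  it and a positive slope after it, hence a critical point in between.\<close>

lemma poly_pos_between:
  fixes h :: "real poly"
  assumes "u < v" "poly h u > 0" "poly h v > 0"
    and nocrit: "\<And>x. u < x \<Longrightarrow> x < v \<Longrightarrow> poly (pderiv h) x \<noteq> 0"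
    and x: "u < x" "x < v"
  shows "poly h x > 0"
proof (rule ccontr)
  assume neg: "\<not> poly h x > 0"
  obtain y where y: "u < y" "y < x" "poly h x - poly h u = (x - u) * poly (pderiv h) y"
    using poly_MVT[OF x(1)] by blast
  obtain z where z: "x < z" "z < v" "poly h v - poly h x = (v - x) * poly (pderiv h) z"
    using poly_MVT[OF x(2)] by blast
  have "(x - u) * poly (pderiv h) y < 0" using y assms neg by linarith
  hence "poly (pderiv h) y < 0" using x by (simp add: mult_less_0_iff)
  moreover have "(v - x) * poly (pderiv h) z > 0" using z assms neg by linarith
  hence "poly (pderiv h) z > 0" using x by (simp add: zero_less_mult_iff)
  moreover have "y < z" using y z by linarith
  ultimately obtain w where "y < w" "w < z" "poly (pderiv h) w = 0"
    using poly_IVT_pos by blast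
  thus False using nocrit[of w] y z by linarith
qed

lemma poly_unique_root_between:
  fixes h :: "real poly"
  assumes "u < v" "poly h u * poly h v < 0"
    and nocrit: "\<And>x. u < x \<Longrightarrow> x < v \<Longrightarrow> poly (pderiv h) x \<noteq> 0"
  shows "\<exists>!x. u < x \<and> x < v \<and> poly h x = 0"
proof -
  have "\<exists>x. u < x \<and> x < v \<and> poly h x = 0"
    using poly_IVT[OF assms(1,2)] by blast
  moreover have "\<not> x < y" if "u < x" "y < v" "poly h x = 0" "poly h y = 0" for x y
  proof
    assume "x < y"
    from poly_MVT[OF this, of h] that nocrit \<open>x < y\<close> show False by force
  qed
  ultimately show ?thesis by (metis linorder_neqE)
qed

lemma poly_sign_at_infinity:
  fixes f :: "real poly"
  assumes "lead_coeff f > 0" "degree f = n"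
  shows "\<exists>a. \<forall>x\<le>a. (-1) ^ n * poly f x > 0" and "\<exists>b. \<forall>x\<ge>b. poly f x > 0"
proof -
  show "\<exists>b. \<forall>x\<ge>b. poly f x > 0"
    using poly_pinfty_gt_lc[OF assms(1)] assms(1) by (meson less_le_trans)
  have "lead_coeff (pcompose f [:0, -1:]) = lead_coeff f * (-1) ^ n"
    by (subst lead_coeff_comp) (simp_all add: assms(2))
  hence "lead_coeff (smult ((-1) ^ n) (pcompose f [:0, -1:])) = ((-1) ^ n * (-1) ^ n) * lead_coeff f"
    by (simp only: lead_coeff_smult mult_ac)
  also have "(-1 :: real) ^ n * (-1) ^ n = 1" by (simp flip: power_mult_distrib)
  finally have *: "lead_coeff (smult ((-1) ^ n) (pcompose f [:0, -1:])) > 0" using assms by simp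
  from poly_pinfty_gt_lc[OF *] * obtain b where
    b: "\<And>x. x \<ge> b \<Longrightarrow> poly (smult ((-1) ^ n) (pcompose f [:0, -1:])) x > 0" by (meson less_le_trans)
  show "\<exists>a. \<forall>x\<le>a. (-1) ^ n * poly f x > 0"
  proof (intro exI[of _ "-b"] allI impI)
    fix x assume "x \<le> -b"
    thus "(-1) ^ n * poly f x > 0" using b[of "-x"] by (simp add: poly_pcompose)
  qed
qed

lemma bracketing_index_exists:
  fixes G :: "nat \<Rightarrow> real"
  assumes "G 0 \<le> x" "x < G n"
  shows "\<exists>j<n. G j \<le> x \<and> x < G (Suc j)"
  using assms
proof (induction n)
  case (Suc n)
  thus ?case by (cases "x < G n") (auto intro: less_SucI)
qed auto

text \<open>The n - 1 prospective critical points cut the line into n intervals. The sign (-1)^n at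
  minus infinity persists through the first 2s of these points and then alternates up to plus
  infinity. So the first 2s intervals contain no root, and each later one contains exactly one by
  monotonicity.\<close>

lemma card_real_roots_of_critical_signs:
  fixes f :: "real poly" and g :: "nat \<Rightarrow> real"
  assumes lc: "lead_coeff f > 0" and deg: "degree f = n" and n: "n > 0" and s: "2 * s \<le> n"
    and mono: "\<And>i j. 1 \<le> i \<Longrightarrow> i < j \<Longrightarrow> j < n \<Longrightarrow> g i < g j"
    and crit: "\<And>x. poly (pderiv f) x = 0 \<Longrightarrow> \<exists>j\<in>{1..<n}. x = g j"
    and A1: "\<And>j. 1 \<le> j \<Longrightarrow> j < n \<Longrightarrow> j \<le> 2 * s \<Longrightarrow> (-1) ^ n * poly f (g j) > 0"
    and A2: "\<And>j. 2 * s < j \<Longrightarrow> j < n \<Longrightarrow> (-1) ^ (n - j) * poly f (g j) > 0"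
  shows "card {x. poly f x = 0} = n - 2 * s"
proof -
  obtain a0 b0 where a0: "\<And>x. x \<le> a0 \<Longrightarrow> (-1) ^ n * poly f x > 0" and b0: "\<And>x. x \<ge> b0 \<Longrightarrow> poly f x > 0"
    using poly_sign_at_infinity[OF lc deg] by blast
  \<comment> \<open>\<open>a\<close> and \<open>b\<close> lie beyond all critical points and where
    the leading term fixes the sign. The entry \<open>a + 1\<close> ensures a < b even without
    critical points. Below, \<open>G\<close> extends \<open>g\<close> by these two
    endpoints.\<close>
  define a where "a = Min (insert a0 ((\<lambda>j. g j - 1) ` {1..<n}))"
  define b where "b = Max (insert b0 (insert (a + 1) ((\<lambda>j. g j + 1) ` {1..<n})))"
  have "a \<le> a0" unfolding a_def by simp
  hence a: "(-1) ^ n * poly f x > 0" if "x \<le> a" for x using a0 that by simp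
  have "b0 \<le> b" unfolding b_def by simp
  hence b: "poly f x > 0" if "b \<le> x" for x using b0 that by simp
  have ag: "a < g j" if "j \<in> {1..<n}" for j
  proof -
    have "a \<le> g j - 1" unfolding a_def by (rule Min_le) (use that in auto)
    thus ?thesis by simp
  qed
  have bg: "g j < b" if "j \<in> {1..<n}" for j
  proof -
    have "g j + 1 \<le> b" unfolding b_def by (rule Max_ge) (use that in auto)
    thus ?thesis by simp
  qed
  have "a + 1 \<le> b" unfolding b_def by (rule Max_ge) auto
  hence ab: "a < b" by simp
  define G where "G = (\<lambda>j. if j = 0 then a else if j < n then g j else b)"
  have G_mono: "G i < G j" if "i < j" "j \<le> n" for i j
    using that ag bg ab mono by (auto simp: G_def)
  have G_less_iff: "G i < G j \<longleftrightarrow> i < j" if "i \<le> n" "j \<le> n" for i j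
    using that G_mono by (metis less_asym less_irrefl linorder_neqE_nat)
  have nocrit: "poly (pderiv f) x \<noteq> 0" if "j < n" "G j < x" "x < G (Suc j)" for j x
  proof
    assume "poly (pderiv f) x = 0"
    then obtain i where i: "i \<in> {1..<n}" "x = g i" using crit by blast
    hence "x = G i" by (simp add: G_def)
    thus False using that G_less_iff[of j i] G_less_iff[of i "Suc j"] i(1) by auto
  qed
  \<comment> \<open>The endpoint j = n occurs here only if n = 2s; then n is even and the positive
    sign at \<open>b\<close> agrees with (-1)^n.\<close>
  have B1: "(-1) ^ n * poly f (G j) > 0" if "j \<le> 2 * s" for j
    using that A1[of j] a[of a] b[of b] s n by (cases "j = n") (auto simp: G_def)
  have B2: "(-1) ^ (n - j) * poly f (G j) > 0" if "2 * s \<le> j" "j \<le> n" for j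
  proof (cases "j = 2 * s")
    case True
    moreover have "(-1 :: real) ^ (n - 2 * s) = (-1) ^ n"
      using s by (simp add: minus_one_power_iff)
    ultimately show ?thesis using B1[of j] by simp
  next
    case False
    thus ?thesis using that A2[of j] b[of b] n by (cases "j = n") (auto simp: G_def)
  qed
  have low: "poly f x \<noteq> 0" if "x \<le> G (2 * s)" for x
  proof (cases "x < G 0 \<or> (\<exists>j\<le>2*s. x = G j)")
    case True
    thus ?thesis using a[of x] B1 by (force simp: G_def)
  next
    case False
    hence "G 0 \<le> x" "x < G (2 * s)" using that by fastforce+
    then obtain j where j: "j < 2 * s" "G j \<le> x" "x < G (Suc j)"
      using bracketing_index_exists by blast
    have "x \<noteq> G j" using False j(1) less_imp_le by blast
    hence "G j < x" using j by simp
    have "poly (smult ((-1) ^ n) f) x > 0"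
    proof (rule poly_pos_between[of "G j" "G (Suc j)"])
      show "G j < G (Suc j)" using j by linarith
      show "poly (smult ((-1) ^ n) f) (G j) > 0" "poly (smult ((-1) ^ n) f) (G (Suc j)) > 0"
        using B1[of j] B1[of "Suc j"] j by auto
      show "poly (pderiv (smult ((- 1) ^ n) f)) y \<noteq> 0" if "G j < y" "y < G (Suc j)" for y
        using nocrit[of j y] that j s by (simp add: pderiv_smult)
    qed (use \<open>G j < x\<close> j in auto)
    thus ?thesis by auto
  qed
  have ex1: "\<exists>!x. G j < x \<and> x < G (Suc j) \<and> poly f x = 0" if j: "2 * s \<le> j" "j < n" for j
  proof (rule poly_unique_root_between)
    show "G j < G (Suc j)" using j by (intro G_mono) auto
    have "n - j = Suc (n - Suc j)" using j by simp
    thus "poly f (G j) * poly f (G (Suc j)) < 0"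
      using B2[of j] B2[of "Suc j"] j
      by (cases "even (n - Suc j)") (simp_all add: minus_one_power_iff mult_less_0_iff)
  qed (use nocrit j in auto)
  define z where "z = (\<lambda>j. THE x. G j < x \<and> x < G (Suc j) \<and> poly f x = 0)"
  have z: "G j < z j" "z j < G (Suc j)" "poly f (z j) = 0" if "2 * s \<le> j" "j < n" for j
    using theI'[OF ex1[OF that]] by (auto simp: z_def)
  have "{x. poly f x = 0} = z ` {2*s..<n}"
  proof (intro equalityI subsetI)
    fix x assume "x \<in> {x. poly f x = 0}"
    hence x: "poly f x = 0" by simp
    have "G (2 * s) < x" using low[of x] x by force
    moreover have "G 0 \<le> G (2 * s)" using G_less_iff[of 0 "2*s"] s by (cases "s = 0") auto
    ultimately have "G 0 \<le> x" by linarith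
    moreover have "x < G n" using b[of x] x n by (force simp: G_def)
    ultimately obtain j where j: "j < n" "G j \<le> x" "x < G (Suc j)" using bracketing_index_exists by blast
    have "2 * s < Suc j" using j \<open>G (2 * s) < x\<close> G_less_iff[of "2 * s" "Suc j"] s by auto
    hence js: "2 * s \<le> j" by simp
    have "poly f (G j) \<noteq> 0" using B2[OF js less_imp_le[OF j(1)]] by auto
    hence "G j \<noteq> x" using x by blast
    hence "G j < x \<and> x < G (Suc j) \<and> poly f x = 0" using j x by simp
    hence "z j = x" unfolding z_def by (rule the1_equality[OF ex1[OF js j(1)]])
    thus "x \<in> z ` {2*s..<n}" using js j by auto
  qed (use z in auto)
  moreover have "inj_on z {2*s..<n}"
  proof (rule inj_onI)
    have le: "\<not> i < j" if "i \<in> {2*s..<n}" "j \<in> {2*s..<n}" "z i = z j" for i j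
    proof
      assume "i < j"
      hence "G (Suc i) \<le> G j" using G_less_iff[of "Suc i" j] that by (cases "Suc i = j") auto
      thus False using z[of i] z[of j] that by simp
    qed
    fix i j assume "i \<in> {2*s..<n}" "j \<in> {2*s..<n}" "z i = z j"
    thus "i = j" using le[of i j] le[of j i] by simp
  qed
  ultimately show ?thesis by (simp add: card_image)
qed

section \<open>Polynomials with widely spaced rational critical points\<close>

lemma eventually_poly_pos_at_top:
  fixes p :: "real poly"
  assumes "coeff p k > 0" and "\<And>i. i > k \<Longrightarrow> coeff p i = 0"
  shows "\<forall>\<^sub>F x in at_top. poly p x > 0"
proof -
  have "degree p \<ge> k" using assms(1) by (intro le_degree) auto
  moreover have "degree p \<le> k" using assms(2) by (intro degree_le) auto
  ultimately have "lead_coeff p > 0" using assms(1) by simp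
  thus ?thesis using poly_pinfty_gt_lc[of p] unfolding eventually_at_top_linorder
    by (meson less_le_trans)
qed

lemma poly_antiderivative_exists:
  fixes p :: "real poly"
  shows "\<exists>q. pderiv q = p \<and> coeff q 0 = 0"
proof (intro exI conjI)
  let ?q = "\<Sum>k\<le>degree p. monom (coeff p k / real (Suc k)) (Suc k)"
  have "pderiv ?q = (\<Sum>k\<le>degree p. monom (coeff p k) k)"
    unfolding pderiv_sum pderiv_monom by (intro sum.cong refl) (simp del: of_nat_Suc)
  thus "pderiv ?q = p" by (simp only: poly_as_sum_of_monoms)
  show "coeff ?q 0 = 0" by (simp add: coeff_sum)
qed

lemma coeff_antiderivative:
  fixes q :: "real poly"
  assumes "pderiv q = p"
  shows "coeff q (Suc k) = coeff p k / real (Suc k)"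
  using assms by (auto simp: coeff_pderiv simp del: of_nat_Suc)

text \<open>A new critical point \<open>x\<close> replaces \<open>B\<close> by \<open>A - x B\<close>, where \<open>A\<close> is an antiderivative of \<open>t B'(t)\<close>.
  For large \<open>x\<close> this flips the signs of the old critical values and keeps their order, while the
  new one grows with a higher power of \<open>x\<close>.\<close>

lemma widely_spaced_critical_points:
  fixes \<theta> :: real and d :: int
  assumes \<theta>: "\<theta> > 0" and d: "d > 0" and m: "m \<ge> 1"
  shows "\<exists>\<gamma> H. \<gamma> 1 = \<theta> \<and> (\<forall>j\<in>{2..m}. \<exists>k. \<gamma> j = of_int (d * k)) \<and>
     (\<forall>j\<in>{1..m}. \<forall>i\<in>{1..<j}. \<gamma> i < \<gamma> j \<and> \<bar>poly H (\<gamma> i)\<bar> < \<bar>poly H (\<gamma> j)\<bar>) \<and>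
     pderiv H = (\<Prod>j\<in>{1..m}. [:- \<gamma> j, 1:]) \<and> coeff H 0 = 0 \<and>
     (\<forall>j\<in>{1..m}. (-1) ^ (m - j) * poly H (\<gamma> j) < 0)"
  using m
proof (induction m rule: dec_induct)
  case base
  show ?case
    by (rule exI[of _ "\<lambda>_. \<theta>"], rule exI[of _ "[:0, -\<theta>, 1/2:]"])
       (use \<theta> in \<open>auto simp: pderiv_pCons\<close>)
next
  case (step m)
  then obtain \<gamma> B where IH: "\<gamma> 1 = \<theta>" "\<And>j. j \<in> {2..m} \<Longrightarrow> \<exists>k. \<gamma> j = of_int (d * k)"
     "\<And>i j. j \<in> {1..m} \<Longrightarrow> i \<in> {1..<j} \<Longrightarrow> \<gamma> i < \<gamma> j"
     "\<And>i j. j \<in> {1..m} \<Longrightarrow> i \<in> {1..<j} \<Longrightarrow> \<bar>poly B (\<gamma> i)\<bar> < \<bar>poly B (\<gamma> j)\<bar>"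
     "pderiv B = (\<Prod>j\<in>{1..m}. [:- \<gamma> j, 1:])" "coeff B 0 = 0"
     "\<And>j. j \<in> {1..m} \<Longrightarrow> (-1) ^ (m - j) * poly B (\<gamma> j) < 0"
    by blast
  define p where "p = (\<Prod>j\<in>{1..m}. [:- \<gamma> j, 1:])"
  have degp: "degree p = m" unfolding p_def by (subst degree_prod_eq_sum_degree) auto
  have lcp: "lead_coeff p = 1" unfolding p_def lead_coeff_prod by simp
  obtain A where A: "pderiv A = pCons 0 p" "coeff A 0 = 0" using poly_antiderivative_exists by blast
  \<comment> \<open>\<open>poly E x\<close> is the value of A - x B at the new critical point x
    itself, now as a polynomial in x. Its leading coefficient is 1/(m+2) - 1/(m+1), which is
    negative.\<close>
  define E where "E = A - pCons 0 B"
  have coeffE: "coeff E (m + 2) < 0" "\<And>i. i > m + 2 \<Longrightarrow> coeff E i = 0"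
  proof -
    have *: "coeff E (Suc (Suc i)) = coeff p i * (1 / real (i + 2) - 1 / real (i + 1))" for i
      using coeff_antiderivative[OF A(1), of "Suc i"] coeff_antiderivative[OF IH(5), of i]
      by (simp add: E_def p_def algebra_simps)
    have "1 / real (m + 2) < 1 / real (m + 1)" by (intro divide_strict_left_mono) auto
    thus "coeff E (m + 2) < 0" using *[of m] lcp degp by simp
    show "coeff E i = 0" if "i > m + 2" for i
      using *[of "i - 2"] that degp by (cases i; cases "i - 1") (auto simp: coeff_eq_0)
  qed
  let ?a = "\<lambda>j. poly A (\<gamma> j)" and ?b = "\<lambda>j. poly B (\<gamma> j)"
  have ev1: "\<forall>\<^sub>F x in at_top. (-1) ^ (Suc m - j) * (?a j - x * ?b j) < 0" if j: "j \<in> {1..m}" for j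
  proof -
    let ?e = "(-1) ^ (m - j) :: real"
    have "\<forall>\<^sub>F x in at_top. poly [:?e * ?a j, - (?e * ?b j):] x > 0"
      by (rule eventually_poly_pos_at_top[of _ 1]) (use IH(7)[OF j] in \<open>auto simp: coeff_pCons split: nat.splits\<close>)
    moreover have "Suc m - j = Suc (m - j)" using j by auto
    ultimately show ?thesis by (simp add: algebra_simps)
  qed
  have ev2: "\<forall>\<^sub>F x in at_top. \<bar>?a i - x * ?b i\<bar> < \<bar>?a j - x * ?b j\<bar>"
    if ij: "j \<in> {1..m}" "i \<in> {1..<j}" for i j
  proof -
    \<comment> \<open>Comparing squares instead of absolute values gives a polynomial inequality in
      x whose leading coefficient is the difference of the squared old critical values.\<close>
    have "(?b i)\<^sup>2 < (?b j)\<^sup>2" using power_strict_mono[OF IH(4)[OF ij], of 2] by simp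
    hence "\<forall>\<^sub>F x in at_top. poly [:(?a j)\<^sup>2 - (?a i)\<^sup>2, 2 * (?a i * ?b i - ?a j * ?b j), (?b j)\<^sup>2 - (?b i)\<^sup>2:] x > 0"
      by (intro eventually_poly_pos_at_top[of _ 2]) (auto simp: coeff_pCons numeral_2_eq_2 split: nat.splits)
    thus ?thesis
    proof eventually_elim
      case (elim x)
      hence "\<bar>?a i - x * ?b i\<bar> ^ 2 < \<bar>?a j - x * ?b j\<bar> ^ 2"
        by (simp add: power2_eq_square algebra_simps)
      thus ?case by (rule power_less_imp_less_base) simp
    qed
  qed
  have ev3: "\<forall>\<^sub>F x in at_top. \<bar>?a j - x * ?b j\<bar> < - poly E x" if "j \<in> {1..m}" for j
  proof -
    have "\<forall>\<^sub>F x in at_top. poly (- E - [:\<bar>?a j\<bar>, \<bar>?b j\<bar>:]) x > 0"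
      by (rule eventually_poly_pos_at_top[of _ "m + 2"])
        (use coeffE step.hyps in \<open>auto simp: coeff_pCons split: nat.splits\<close>)
    thus ?thesis using eventually_ge_at_top[of 0]
    proof eventually_elim
      case (elim x)
      have "\<bar>?a j - x * ?b j\<bar> \<le> \<bar>?a j\<bar> + \<bar>x * ?b j\<bar>" by (rule abs_triangle_ineq4)
      thus ?case using elim by (simp add: abs_mult)
    qed
  qed
  have "\<forall>\<^sub>F x in at_top. (\<forall>j\<in>{1..m}. (-1) ^ (Suc m - j) * (?a j - x * ?b j) < 0 \<and>
      (\<forall>i\<in>{1..<j}. \<bar>?a i - x * ?b i\<bar> < \<bar>?a j - x * ?b j\<bar>) \<and>
      \<bar>?a j - x * ?b j\<bar> < - poly E x \<and> \<gamma> j < x) \<and> poly (- E) x > 0"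
    by (intro eventually_conj eventually_ball_finite ballI ev1 ev2 ev3 eventually_gt_at_top
        eventually_poly_pos_at_top[of _ "m + 2"]) (use coeffE in auto)
  then obtain x0 where x0: "\<And>x j. x \<ge> x0 \<Longrightarrow> j \<in> {1..m} \<Longrightarrow> (-1) ^ (Suc m - j) * (?a j - x * ?b j) < 0"
     "\<And>x i j. x \<ge> x0 \<Longrightarrow> j \<in> {1..m} \<Longrightarrow> i \<in> {1..<j} \<Longrightarrow> \<bar>?a i - x * ?b i\<bar> < \<bar>?a j - x * ?b j\<bar>"
     "\<And>x j. x \<ge> x0 \<Longrightarrow> j \<in> {1..m} \<Longrightarrow> \<bar>?a j - x * ?b j\<bar> < - poly E x"
     "\<And>x j. x \<ge> x0 \<Longrightarrow> j \<in> {1..m} \<Longrightarrow> \<gamma> j < x"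
     "\<And>x. x \<ge> x0 \<Longrightarrow> poly E x < 0"
    unfolding eventually_at_top_linorder by fastforce
  \<comment> \<open>The new critical point is a multiple of \<open>d\<close> beyond the threshold;
    \<open>max 0\<close> ensures k \<le> d k.\<close>
  define k where "k = max 0 \<lceil>x0\<rceil>"
  define x where "x = real_of_int (d * k)"
  have "x0 \<le> of_int k" unfolding k_def by linarith
  also have "k \<le> d * k" using d mult_right_mono[of 1 d k] by (simp add: k_def)
  finally have xge: "x \<ge> x0" by (simp add: x_def)
  define H where "H = A - smult x B"
  define \<gamma>' where "\<gamma>' = \<gamma>(Suc m := x)"
  have g': "\<gamma>' j = \<gamma> j" if "j \<in> {1..m}" for j using that by (simp add: \<gamma>'_def)
  have gS: "\<gamma>' (Suc m) = x" by (simp add: \<gamma>'_def)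
  have H: "poly H (\<gamma> j) = ?a j - x * ?b j" for j by (simp add: H_def)
  have HS: "poly H x = poly E x" by (simp add: H_def E_def)
  have "pderiv H = p * [:-x, 1:]"
    by (simp add: H_def pderiv_diff pderiv_smult A IH(5) p_def)
  also have "\<dots> = (\<Prod>j\<in>{1..Suc m}. [:- \<gamma>' j, 1:])"
    by (simp add: p_def gS g' atLeastAtMostSuc_conv)
  finally have pH: "pderiv H = (\<Prod>j\<in>{1..Suc m}. [:- \<gamma>' j, 1:])" .
  have "(\<forall>j\<in>{1..Suc m}. \<forall>i\<in>{1..<j}. \<gamma>' i < \<gamma>' j \<and> \<bar>poly H (\<gamma>' i)\<bar> < \<bar>poly H (\<gamma>' j)\<bar>)"
  proof (intro ballI)
    fix i j assume ij: "j \<in> {1..Suc m}" "i \<in> {1..<j}"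
    show "\<gamma>' i < \<gamma>' j \<and> \<bar>poly H (\<gamma>' i)\<bar> < \<bar>poly H (\<gamma>' j)\<bar>"
    proof (cases "j = Suc m")
      case True
      thus ?thesis using ij x0(3,4)[OF xge, of i] x0(5)[OF xge] by (auto simp: g' gS H HS)
    next
      case False
      thus ?thesis using ij x0(2)[OF xge, of j i] IH(3)[of j i] by (auto simp: g' gS H)
    qed
  qed
  moreover have "\<forall>j\<in>{1..Suc m}. (-1) ^ (Suc m - j) * poly H (\<gamma>' j) < 0"
  proof
    fix j assume j: "j \<in> {1..Suc m}"
    show "(-1) ^ (Suc m - j) * poly H (\<gamma>' j) < 0"
    proof (cases "j = Suc m")
      case True
      thus ?thesis using x0(5)[OF xge] by (simp add: gS HS)
    next
      case False
      thus ?thesis using j x0(1)[OF xge, of j] by (simp add: g' H)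
    qed
  qed
  moreover have "\<forall>j\<in>{2..Suc m}. \<exists>k. \<gamma>' j = of_int (d * k)"
  proof
    fix j assume "j \<in> {2..Suc m}"
    thus "\<exists>k. \<gamma>' j = of_int (d * k)"
      using IH(2)[of j] g'[of j] gS x_def by (cases "j = Suc m") force+
  qed
  moreover have "\<gamma>' 1 = \<theta>" using g'[of 1] IH(1) step.hyps by simp
  moreover have "coeff H 0 = 0" using A IH(6) by (simp add: H_def)
  ultimately show ?case using pH by blast
qed

section \<open>Integrality of the seed polynomial\<close>

lemma prod_linear_cong_monom:
  fixes c :: "'a \<Rightarrow> int"
  assumes "finite J" "\<And>j. j \<in> J \<Longrightarrow> d dvd c j"
  shows "\<exists>h. (\<Prod>j\<in>J. [:- c j, 1:]) = monom 1 (card J) + smult d h"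
  using assms
proof (induction J rule: finite_induct)
  case empty
  show ?case by (rule exI[of _ 0]) simp
next
  case (insert a J)
  then obtain h where h: "(\<Prod>j\<in>J. [:- c j, 1:]) = monom 1 (card J) + smult d h" by auto
  obtain k where k: "c a = d * k" using insert.prems[of a] by auto
  have "(\<Prod>j\<in>insert a J. [:- c j, 1:]) = [:- c a, 1:] * (monom 1 (card J) + smult d h)"
    using insert.hyps h by simp
  also have "\<dots> = monom 1 (card (insert a J)) + smult d (smult (-k) (monom 1 (card J)) + [:- c a, 1:] * h)"
    using insert.hyps by (simp add: k algebra_simps monom_Suc smult_monom smult_add_right smult_diff_right)
  finally show ?case by blast
qed

lemma int_poly_antiderivative_exists:
  fixes R :: "int poly"
  assumes "\<And>k. int (Suc k) dvd coeff R k"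
  shows "\<exists>Q. pderiv Q = R \<and> coeff Q 0 = 0"
proof (intro exI conjI)
  let ?q = "\<Sum>k\<le>degree R. monom (coeff R k div int (Suc k)) (Suc k)"
  have "pderiv ?q = (\<Sum>k\<le>degree R. monom (coeff R k) k)"
    unfolding pderiv_sum pderiv_monom
    by (intro sum.cong refl arg_cong2[where f = monom]) (use assms in \<open>simp_all del: of_nat_Suc\<close>)
  thus "pderiv ?q = R" by (simp only: poly_as_sum_of_monoms)
  show "coeff ?q 0 = 0" by (simp add: coeff_sum)
qed

text \<open>The critical points from the second on are multiples of n!. Modulo n! the derivative is
  therefore n x^(n-1) - (n-1) x^(n-2), whose coefficients are divisible by exactly the denominators
  n and n - 1 that integration introduces; elsewhere n! absorbs them.\<close>

lemma seed_polynomial_exists: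
  fixes n :: nat
  assumes n: "n \<ge> 2"
  shows "\<exists>(Q :: int poly) (c :: nat \<Rightarrow> int) (\<gamma> :: nat \<Rightarrow> real).
     lead_coeff Q = 1 \<and> degree Q = n \<and> coeff Q 0 = 0 \<and>
     \<gamma> 1 = (real n - 1) / real n \<and> (\<forall>j\<in>{2..<n}. \<gamma> j = of_int (c j) \<and> fact n dvd c j) \<and>
     (\<forall>j\<in>{1..<n}. \<forall>i\<in>{1..<j}. \<gamma> i < \<gamma> j \<and>
         \<bar>poly (map_poly of_int Q) (\<gamma> i)\<bar> < \<bar>poly (map_poly of_int Q) (\<gamma> j)\<bar>) \<and>
     map_poly of_int (pderiv Q) = smult (real n) (\<Prod>j\<in>{1..<n}. [:- \<gamma> j, 1:]) \<and>
     (\<forall>j\<in>{1..<n}. (-1) ^ (n - j) * poly (map_poly of_int Q) (\<gamma> j) > 0)"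
proof -
  define \<theta> where "\<theta> = (real n - 1) / real n"
  have \<theta>: "\<theta> > 0" using n by (simp add: \<theta>_def)
  have iv: "{1..n - 1} = {1..<n}" "{2..n - 1} = {2..<n}" using n by auto
  obtain \<gamma> H where \<gamma>1: "\<gamma> 1 = \<theta>" and \<gamma>k: "\<forall>j\<in>{2..<n}. \<exists>k. \<gamma> j = of_int (fact n * k)"
    and mono: "\<forall>j\<in>{1..<n}. \<forall>i\<in>{1..<j}. \<gamma> i < \<gamma> j \<and> \<bar>poly H (\<gamma> i)\<bar> < \<bar>poly H (\<gamma> j)\<bar>"
    and H: "pderiv H = (\<Prod>j\<in>{1..<n}. [:- \<gamma> j, 1:])" "coeff H 0 = 0"
    and sgn: "\<forall>j\<in>{1..<n}. (-1) ^ (n - 1 - j) * poly H (\<gamma> j) < 0"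
  proof -
    have "fact n > (0::int)" "n - 1 \<ge> 1" using n by auto
    from widely_spaced_critical_points[OF \<theta> this] show thesis
      unfolding iv using that by blast
  qed
  from \<gamma>k obtain k where k: "\<And>j. j \<in> {2..<n} \<Longrightarrow> \<gamma> j = of_int (fact n * k j)" by metis
  define c where "c = (\<lambda>j. fact n * k j)"
  define R where "R = [:- (int n - 1), int n:] * (\<Prod>j\<in>{2..<n}. [:- c j, 1:])"
  obtain h where h: "(\<Prod>j\<in>{2..<n}. [:- c j, 1:]) = monom 1 (n - 2) + smult (fact n) h"
    using prod_linear_cong_monom[of "{2..<n}" "fact n" c] by (auto simp: c_def)
  have dR: "degree R = n - 1" "lead_coeff R = int n"
  proof -
    have "degree (\<Prod>j\<in>{2..<n}. [:- c j, 1:]) = n - 2" by (subst degree_prod_eq_sum_degree) auto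
    moreover have l: "lead_coeff (\<Prod>j\<in>{2..<n}. [:- c j, 1:]) = 1" by (simp add: lead_coeff_prod)
    hence "(\<Prod>j\<in>{2..<n}. [:- c j, 1:]) \<noteq> 0" by (metis coeff_0 zero_neq_one)
    ultimately show "degree R = n - 1"
      unfolding R_def using n by (subst degree_mult_eq) auto
    show "lead_coeff R = int n"
      unfolding R_def lead_coeff_mult l using n by simp
  qed
  have "int (Suc i) dvd coeff R i" for i
  proof (cases "i < n")
    case True
    have R: "R = monom (- (int n - 1)) (n - 2) + monom (int n) (Suc (n - 2)) +
         smult (fact n) ([:- (int n - 1), int n:] * h)"
      by (simp add: R_def h algebra_simps smult_monom monom_Suc smult_add_right)
    have "Suc i dvd fact n" using True by (intro dvd_fact) auto
    hence "int (Suc i) dvd int (fact n)" by (simp only: int_dvd_int_iff)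
    hence "int (Suc i) dvd fact n" by (simp only: of_nat_fact)
    moreover have "int (Suc i) dvd coeff (monom (- (int n - 1)) (n - 2) + monom (int n) (Suc (n - 2))) i"
      using n dvd_minus_iff[of "int n - 1" "int n - 1"] by (auto simp: of_nat_diff)
    ultimately show ?thesis unfolding R by simp
  next
    case False
    thus ?thesis using dR n by (simp add: coeff_eq_0)
  qed
  then obtain Q where Q: "pderiv Q = R" "coeff Q 0 = 0" using int_poly_antiderivative_exists by blast
  have dQ: "degree Q = n"
    using degree_pderiv[of Q] dR n Q(1) by (cases "degree Q") auto
  have "int n * lead_coeff Q = int n"
    using coeff_pderiv[of Q "n - 1"] dR n Q(1) dQ by simp
  hence lQ: "lead_coeff Q = 1" using n by simp
  have "map_poly of_int R = [:- (real n - 1), real n:] * (\<Prod>j\<in>{2..<n}. [:- \<gamma> j, 1:])"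
    unfolding R_def of_int_poly_hom.hom_mult of_int_poly_hom.hom_prod
    by (intro arg_cong2[where f = "(*)"] prod.cong)
      (auto simp: k c_def of_int_hom.map_poly_pCons_hom)
  also have "[:- (real n - 1), real n:] = smult (real n) [:- \<gamma> 1, 1:]"
    using n \<gamma>1 by (simp add: \<theta>_def)
  also have "\<dots> * (\<Prod>j\<in>{2..<n}. [:- \<gamma> j, 1:]) = smult (real n) (\<Prod>j\<in>{1..<n}. [:- \<gamma> j, 1:])"
    using n by (subst prod.atLeast_Suc_lessThan[of 1 n]) (auto simp: numeral_2_eq_2 smult_diff_right)
  finally have R: "map_poly of_int R = smult (real n) (\<Prod>j\<in>{1..<n}. [:- \<gamma> j, 1:])" .
  \<comment> \<open>\<open>Q\<close> and n H have the same derivative and both vanish at 0, so the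
    sign and size properties of \<open>H\<close> carry over.\<close>
  have "pderiv (map_poly of_int Q) = pderiv (smult (real n) H)"
    by (simp add: Q R H pderiv_smult flip: of_int_hom.map_poly_pderiv)
  hence "pderiv (map_poly of_int Q - smult (real n) H) = 0" by (simp add: pderiv_diff)
  moreover have "coeff (map_poly of_int Q - smult (real n) H) 0 = 0" using Q H by simp
  ultimately have QH: "map_poly of_int Q = smult (real n) H"
    by (metis degree_eq_zeroE coeff_pCons_0 eq_iff_diff_eq_0 pCons_0_0 pderiv_eq_0_iff)
  have "(-1) ^ (n - j) * poly H (\<gamma> j) > 0" if "j \<in> {1..<n}" for j
  proof -
    have "n - j = Suc (n - 1 - j)" using that by auto
    thus ?thesis using sgn that by auto
  qed
  hence "\<forall>j\<in>{1..<n}. (-1) ^ (n - j) * poly (map_poly of_int Q) (\<gamma> j) > 0"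
    using n by (simp add: QH mult.left_commute)
  moreover have "\<forall>j\<in>{1..<n}. \<forall>i\<in>{1..<j}. \<gamma> i < \<gamma> j \<and>
         \<bar>poly (map_poly of_int Q) (\<gamma> i)\<bar> < \<bar>poly (map_poly of_int Q) (\<gamma> j)\<bar>"
    using mono n by (simp add: QH abs_mult)
  ultimately show ?thesis using lQ dQ Q R k \<gamma>1
    by (intro exI[of _ Q] exI[of _ c] exI[of _ \<gamma>]) (auto simp: \<theta>_def c_def)
qed

section \<open>The squarefree sieve\<close>

lemma card_int_open_interval:
  fixes x y :: real
  assumes "x \<le> y"
  shows "finite {k :: int. x < of_int k \<and> of_int k < y}"
    and "y - x - 1 \<le> real (card {k :: int. x < of_int k \<and> of_int k < y})"
    and "real (card {k :: int. x < of_int k \<and> of_int k < y}) \<le> y - x + 1"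
proof -
  have *: "{k :: int. x < of_int k \<and> of_int k < y} = {\<lfloor>x\<rfloor> + 1..\<lceil>y\<rceil> - 1}"
    by (auto simp: floor_less_iff less_ceiling_iff) linarith+
  show "finite {k :: int. x < of_int k \<and> of_int k < y}" unfolding * by simp
  show "y - x - 1 \<le> real (card {k :: int. x < of_int k \<and> of_int k < y})"
    and "real (card {k :: int. x < of_int k \<and> of_int k < y}) \<le> y - x + 1"
    unfolding * using assms by (simp_all add: of_nat_nat max_def) linarith+
qed

lemma card_residue_class_ge:
  fixes lo hi :: real and m b :: int
  assumes "lo \<le> hi" "m > 0"
  shows "finite {k :: int. lo < of_int k \<and> of_int k < hi \<and> [k = b] (mod m)}"
    and "(hi - lo) / of_int m - 1 \<le> real (card {k :: int. lo < of_int k \<and> of_int k < hi \<and> [k = b] (mod m)})"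
proof -
  let ?A = "{k :: int. lo < of_int k \<and> of_int k < hi \<and> [k = b] (mod m)}"
  show fin: "finite ?A" using card_int_open_interval(1)[OF assms(1)] by (rule rev_finite_subset) auto
  let ?B = "{k :: int. (lo - of_int b) / of_int m < of_int k \<and> of_int k < (hi - of_int b) / of_int m}"
  have le: "(lo - of_int b) / of_int m \<le> (hi - of_int b) / of_int m"
    using assms by (simp add: divide_right_mono)
  have "(\<lambda>k. b + m * k) ` ?B \<subseteq> ?A"
    using assms(2) by (auto simp: field_simps cong_iff_dvd_diff)
  from card_mono[OF fin this] have "card ((\<lambda>k. b + m * k) ` ?B) \<le> card ?A" .
  moreover have "card ((\<lambda>k. b + m * k) ` ?B) = card ?B"
    using assms(2) by (intro card_image inj_onI) auto
  moreover have "(hi - lo) / of_int m - 1 \<le> real (card ?B)"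
    using card_int_open_interval(2)[OF le] by (simp add: diff_divide_distrib)
  ultimately show "(hi - lo) / of_int m - 1 \<le> real (card ?A)" by linarith
qed

lemma card_congruent_le:
  fixes lo hi :: real and m :: int
  assumes "lo \<le> hi" "m > 0"
    and A: "\<And>k. k \<in> A \<Longrightarrow> lo < of_int k \<and> of_int k < hi"
    and cong: "\<And>k l. k \<in> A \<Longrightarrow> l \<in> A \<Longrightarrow> [k = l] (mod m)"
  shows "real (card A) \<le> (hi - lo) / of_int m + 1"
proof (cases "A = {}")
  case True
  thus ?thesis using assms by simp
next
  case False
  then obtain b where b: "b \<in> A" by blast
  let ?B = "{k :: int. (lo - of_int b) / of_int m < of_int k \<and> of_int k < (hi - of_int b) / of_int m}"
  have le: "(lo - of_int b) / of_int m \<le> (hi - of_int b) / of_int m"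
    using assms by (simp add: divide_right_mono)
  have "A \<subseteq> (\<lambda>k. b + m * k) ` ?B"
  proof
    fix k assume k: "k \<in> A"
    obtain l where l: "k - b = m * l" using cong[OF k b] by (auto simp: cong_iff_dvd_diff elim: dvdE)
    have "of_int k = (of_int b :: real) + of_int m * of_int l" using l by (metis add.commute diff_add_cancel of_int_add of_int_mult)
    hence "l \<in> ?B" using A[OF k] assms(2) by (simp add: field_simps)
    thus "k \<in> (\<lambda>k. b + m * k) ` ?B" using l by (intro image_eqI[of _ _ l]) auto
  qed
  hence "card A \<le> card ?B"
    using card_int_open_interval(1)[OF le] by (meson card_image_le card_mono finite_imageI le_trans)
  moreover have "real (card ?B) \<le> (hi - lo) / of_int m + 1"
    using card_int_open_interval(3)[OF le] by (simp add: diff_divide_distrib)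
  ultimately show ?thesis by linarith
qed

text \<open>Telescoping: 1/(K+1)^2 is at most 1/K - 1/(K+1).\<close>

lemma sum_inverse_squares_le:
  assumes "z > 0"
  shows "(\<Sum>p\<in>{z<..K}. 1 / (real p)\<^sup>2) \<le> 1 / real z"
proof (cases "z \<le> K")
  case True
  hence "(\<Sum>p\<in>{z<..K}. 1 / (real p)\<^sup>2) \<le> 1 / real z - 1 / real K"
  proof (induction K rule: dec_induct)
    case (step K)
    have K: "K > 0" using step.hyps assms by simp
    have "{z<..Suc K} = insert (Suc K) {z<..K}" using step.hyps by auto
    hence "(\<Sum>p\<in>{z<..Suc K}. 1 / (real p)\<^sup>2) \<le> 1 / (real (Suc K))\<^sup>2 + (1 / real z - 1 / real K)"
      using step.IH by simp
    also have "1 / (real (Suc K))\<^sup>2 \<le> 1 / (real K * real (Suc K))"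
      using K by (intro divide_left_mono) (auto simp: power2_eq_square)
    also have "\<dots> = 1 / real K - 1 / real (Suc K)" using K by (simp add: field_simps)
    finally show ?case by simp
  qed simp
  also have "\<dots> \<le> 1 / real z" by simp
  finally show ?thesis .
qed simp

text \<open>A prime whose square divides the product exceeds \<open>z\<close> by
  \<open>small\<close>, and by \<open>two\<close> its square divides a single form, so it is at most
  sqrt Y. Each such prime and form exclude at most one class modulo W p^2. Summing len/p^2 + 1 over
  z < p \<le> sqrt Y gives the two error terms. The absolute value of \<open>Y\<close> keeps the
  error nonnegative even when \<open>Y\<close> is unconstrained because there are no values.\<close>

lemma card_squarefree_values_ge:
  fixes \<alpha> \<beta> :: "'a \<Rightarrow> int" and W b0 :: int and lo hi Y :: real and z :: nat
  defines "F \<equiv> \<lambda>i b. \<alpha> i * b + \<beta> i"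
  defines "B \<equiv> {b :: int. lo < of_int b \<and> of_int b < hi \<and> [b = b0] (mod W)}"
  assumes I: "finite I" and z: "z > 0" and W: "W > 0" and lohi: "lo \<le> hi"
    and nz: "\<And>i b. i \<in> I \<Longrightarrow> b \<in> B \<Longrightarrow> F i b \<noteq> 0"
    and Y: "\<And>i b. i \<in> I \<Longrightarrow> b \<in> B \<Longrightarrow> of_int \<bar>F i b\<bar> \<le> Y"
    and small: "\<And>i b p. i \<in> I \<Longrightarrow> b \<in> B \<Longrightarrow> prime p \<Longrightarrow> p \<le> z \<Longrightarrow> \<not> int p dvd F i b"
    and cop: "\<And>i p. i \<in> I \<Longrightarrow> prime p \<Longrightarrow> p > z \<Longrightarrow> coprime (int p) (\<alpha> i) \<and> coprime (int p) W"
    and two: "\<And>i j b p. i \<in> I \<Longrightarrow> j \<in> I \<Longrightarrow> i \<noteq> j \<Longrightarrow> b \<in> B \<Longrightarrow> prime p \<Longrightarrow> p > z \<Longrightarrow>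
                int p dvd F i b \<Longrightarrow> \<not> int p dvd F j b"
  shows "real (card {b\<in>B. squarefree (\<Prod>i\<in>I. F i b)}) \<ge>
           (hi - lo) / of_int W - 1 - real (card I) * ((hi - lo) / (of_int W * real z) + sqrt \<bar>Y\<bar>)"
proof -
  define K where "K = nat \<lfloor>sqrt \<bar>Y\<bar>\<rfloor>"
  define Pr where "Pr = {p \<in> {z<..K}. prime p}"
  define bad where "bad = (\<lambda>i p. {b \<in> B. (int p)\<^sup>2 dvd F i b})"
  define len where "len = (hi - lo) / of_int W"
  note B = card_residue_class_ge[OF lohi W, of b0, folded B_def]
  have bad: "real (card (bad i p)) \<le> len * (1 / (real p)\<^sup>2) + 1" if i: "i \<in> I" and p: "p \<in> Pr" for i p
  proof -
    have pp: "prime p" "p > z" using p by (auto simp: Pr_def)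
    have m0: "W * (int p)\<^sup>2 > 0" using W pp by (simp add: prime_gt_0_nat)
    have "real (card (bad i p)) \<le> (hi - lo) / of_int (W * (int p)\<^sup>2) + 1"
    proof (rule card_congruent_le[OF lohi m0])
      fix k assume "k \<in> bad i p"
      thus "lo < of_int k \<and> of_int k < hi" by (simp add: bad_def B_def)
    next
      fix k l assume kl: "k \<in> bad i p" "l \<in> bad i p"
      have "[k = b0] (mod W)" "[l = b0] (mod W)" using kl by (auto simp: bad_def B_def)
      hence "[k = l] (mod W)" using cong_sym cong_trans by blast
      \<comment> \<open>The slope \<open>\<alpha> i\<close> is invertible modulo \<open>p\<close>,
        so the condition on the form fixes the class of b modulo p^2.\<close>
      moreover have "(int p)\<^sup>2 dvd F i k - F i l" using kl by (auto simp: bad_def)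
      hence "(int p)\<^sup>2 dvd \<alpha> i * (k - l)" by (simp add: F_def algebra_simps)
      hence "[k = l] (mod (int p)\<^sup>2)" using cop[OF i pp]
        by (simp add: cong_iff_dvd_diff coprime_dvd_mult_right_iff)
      moreover have "coprime W ((int p)\<^sup>2)" using cop[OF i pp] by (simp add: coprime_commute)
      ultimately show "[k = l] (mod W * (int p)\<^sup>2)" by (rule coprime_cong_mult)
    qed
    thus ?thesis by (simp add: len_def)
  qed
  have sub: "B - {b\<in>B. squarefree (\<Prod>i\<in>I. F i b)} \<subseteq> (\<Union>i\<in>I. \<Union>p\<in>Pr. bad i p)"
  proof
    fix b assume "b \<in> B - {b\<in>B. squarefree (\<Prod>i\<in>I. F i b)}"
    hence b: "b \<in> B" and nsq: "\<not> squarefree (\<Prod>i\<in>I. F i b)" by auto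
    have "(\<Prod>i\<in>I. F i b) \<noteq> 0" using nz b I by simp
    from squarefree_factorial_semiring[OF this] nsq
    obtain p' :: int where p': "prime p'" "p'\<^sup>2 dvd (\<Prod>i\<in>I. F i b)" by blast
    define p where "p = nat p'"
    have p: "p' = int p" using prime_ge_0_int[OF p'(1)] by (simp add: p_def)
    hence pr: "prime p" using p'(1) by simp
    have "p' dvd (\<Prod>i\<in>I. F i b)" using p'(2) unfolding power2_eq_square by (rule dvd_mult_left)
    hence "\<exists>i\<in>I. p' dvd F i b" using prime_dvd_prod_iff[OF I p'(1), of "\<lambda>i. F i b"] by simp
    then obtain i where i: "i \<in> I" "int p dvd F i b" using p by blast
    have pz: "p > z" using small[OF i(1) b pr] i(2) by (meson not_le)
    have "coprime (int p) (\<Prod>j\<in>I - {i}. F j b)"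
    proof (rule prod_coprime_right)
      fix j assume "j \<in> I - {i}"
      hence "\<not> int p dvd F j b" using two[OF i(1) _ _ b pr pz i(2), of j] by auto
      thus "coprime (int p) (F j b)" using p'(1) p by (simp add: prime_imp_coprime)
    qed
    moreover have "(int p)\<^sup>2 dvd F i b * (\<Prod>j\<in>I - {i}. F j b)"
      using p'(2) unfolding p prod.remove[OF I i(1)] .
    ultimately have dvd: "(int p)\<^sup>2 dvd F i b" by (simp add: coprime_dvd_mult_left_iff)
    hence "(int p)\<^sup>2 \<le> \<bar>F i b\<bar>" using nz[OF i(1) b] by (intro zdvd_imp_le) auto
    hence "real_of_int ((int p)\<^sup>2) \<le> of_int \<bar>F i b\<bar>" by (simp only: of_int_le_iff)
    hence "(real p)\<^sup>2 \<le> \<bar>Y\<bar>" using Y[OF i(1) b] by simp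
    hence "real p \<le> sqrt \<bar>Y\<bar>" by (rule real_le_rsqrt)
    hence "p \<le> K" unfolding K_def by (simp add: le_nat_floor)
    hence "p \<in> Pr" using pz pr by (simp add: Pr_def)
    moreover have "b \<in> bad i p" using b dvd by (simp add: bad_def)
    ultimately show "b \<in> (\<Union>i\<in>I. \<Union>p\<in>Pr. bad i p)" using i(1) by blast
  qed
  have finPr: "finite Pr" by (simp add: Pr_def)
  have len0: "len \<ge> 0" using lohi W by (simp add: len_def)
  have "(\<Sum>p\<in>Pr. real (card (bad i p))) \<le> len / real z + sqrt \<bar>Y\<bar>" if i: "i \<in> I" for i
  proof -
    have "(\<Sum>p\<in>Pr. real (card (bad i p))) \<le> (\<Sum>p\<in>Pr. len * (1 / (real p)\<^sup>2) + 1)"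
      by (intro sum_mono bad i)
    \<comment> \<open>The crude passage from primes to all integers is affordable: both resulting
      sums are small enough.\<close>
    also have "\<dots> \<le> (\<Sum>p\<in>{z<..K}. len * (1 / (real p)\<^sup>2) + 1)"
      using len0 by (intro sum_mono2) (auto simp: Pr_def)
    also have "\<dots> = len * (\<Sum>p\<in>{z<..K}. 1 / (real p)\<^sup>2) + real (K - z)"
      by (simp add: sum.distrib sum_distrib_left)
    also have "\<dots> \<le> len * (1 / real z) + sqrt \<bar>Y\<bar>"
    proof (intro add_mono mult_left_mono sum_inverse_squares_le z len0)
      have "real (K - z) \<le> real K" by simp
      also have "real K \<le> sqrt \<bar>Y\<bar>" unfolding K_def by (simp add: of_nat_nat)
      finally show "real (K - z) \<le> sqrt \<bar>Y\<bar>" .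
    qed
    finally show ?thesis by simp
  qed
  hence "(\<Sum>i\<in>I. \<Sum>p\<in>Pr. real (card (bad i p))) \<le> (\<Sum>i\<in>I. len / real z + sqrt \<bar>Y\<bar>)"
    by (intro sum_mono)
  hence S: "(\<Sum>i\<in>I. \<Sum>p\<in>Pr. real (card (bad i p))) \<le> real (card I) * (len / real z + sqrt \<bar>Y\<bar>)"
    by simp
  have finbad: "finite (bad i p)" for i p using B(1) by (simp add: bad_def)
  have "card B - card {b\<in>B. squarefree (\<Prod>i\<in>I. F i b)} \<le> card (B - {b\<in>B. squarefree (\<Prod>i\<in>I. F i b)})"
    using B(1) by (simp add: card_Diff_subset)
  also have "\<dots> \<le> card (\<Union>i\<in>I. \<Union>p\<in>Pr. bad i p)"
    by (intro card_mono sub) (use I finPr finbad in auto)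
  also have "\<dots> \<le> (\<Sum>i\<in>I. \<Sum>p\<in>Pr. card (bad i p))"
    by (rule order_trans[OF card_UN_le[OF I]]) (intro sum_mono card_UN_le finPr)
  finally have "real (card B) - real (card {b\<in>B. squarefree (\<Prod>i\<in>I. F i b)}) \<le>
      real (\<Sum>i\<in>I. \<Sum>p\<in>Pr. card (bad i p))" by linarith
  also have "\<dots> = (\<Sum>i\<in>I. \<Sum>p\<in>Pr. real (card (bad i p)))" by simp
  finally have "real (card B) - real (card {b\<in>B. squarefree (\<Prod>i\<in>I. F i b)}) \<le>
      real (card I) * (len / real z + sqrt \<bar>Y\<bar>)" using S by linarith
  thus ?thesis using B(2) by (simp add: len_def)
qed

section \<open>The family of polynomials\<close>

text \<open>This is T^m R(x/T) for R of degree at most \<open>m\<close>, written without division so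
  that it stays integral and makes sense for T = 0.\<close>

definition scaled :: "nat \<Rightarrow> int \<Rightarrow> int poly \<Rightarrow> int poly" where
  "scaled m T R = (\<Sum>k\<le>m. monom (coeff R k * T ^ (m - k)) k)"

lemma coeff_scaled: "coeff (scaled m T R) k = (if k \<le> m then coeff R k * T ^ (m - k) else 0)"
  by (simp add: scaled_def coeff_sum)

lemma pderiv_scaled: "pderiv (scaled (Suc m) T R) = scaled m T (pderiv R)"
  by (rule poly_eqI) (simp add: coeff_pderiv coeff_scaled mult.assoc)

lemma poly_of_int_scaled:
  fixes x :: "'a :: field_char_0"
  assumes "degree R \<le> m"
  shows "poly (map_poly of_int (scaled m T R)) (of_int T * x) = of_int T ^ m * poly (map_poly of_int R) x"
proof -
  have alt: "poly (map_poly of_int p) y = (\<Sum>k\<le>m. of_int (coeff p k) * y ^ k)"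
    if "degree p \<le> m" for p :: "int poly" and y :: 'a
    unfolding poly_altdef
    using that by (simp, intro sum.mono_neutral_left) (auto simp: coeff_eq_0)
  have "degree (scaled m T R) \<le> m" by (rule degree_le) (simp add: coeff_scaled)
  hence "poly (map_poly of_int (scaled m T R)) (of_int T * x) =
        (\<Sum>k\<le>m. of_int (coeff R k) * (of_int T ^ (m - k) * of_int T ^ k) * x ^ k)"
    by (simp add: alt coeff_scaled power_mult_distrib mult_ac)
  also have "\<dots> = (\<Sum>k\<le>m. of_int T ^ m * (of_int (coeff R k) * x ^ k))"
    by (intro sum.cong) (auto simp flip: power_add)
  finally show ?thesis using assms by (simp add: alt sum_distrib_left)
qed

text \<open>Only \<open>\<gamma> 1\<close> is not an integer: its denominator absorbs the leading coefficient \<open>n\<close> of the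
  derivative, and the numerator \<open>n - 1\<close> makes \<open>Q\<close> integral. The linear form belonging to \<open>\<gamma> j\<close> is
  \<open>a j * b + T\<^sup>n * v j\<close>.\<close>

locale seed =
  fixes n :: nat and Q :: "int poly" and c :: "nat \<Rightarrow> int" and \<gamma> :: "nat \<Rightarrow> real"
  assumes n2: "n \<ge> 2"
    and lead_Q: "lead_coeff Q = 1" and deg_Q: "degree Q = n" and Q_0: "coeff Q 0 = 0"
    and crit_1: "\<gamma> 1 = (real n - 1) / real n"
    and crit_int: "j \<in> {2..<n} \<Longrightarrow> \<gamma> j = of_int (c j)"
    and fact_dvd: "j \<in> {2..<n} \<Longrightarrow> fact n dvd c j"
    and crit_less: "j < n \<Longrightarrow> i \<in> {1..<j} \<Longrightarrow> \<gamma> i < \<gamma> j"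
    and abs_less: "j < n \<Longrightarrow> i \<in> {1..<j} \<Longrightarrow>
          \<bar>poly (map_poly of_int Q) (\<gamma> i)\<bar> < \<bar>poly (map_poly of_int Q) (\<gamma> j)\<bar>"
    and pderiv_Q: "map_poly of_int (pderiv Q) = smult (real n) (\<Prod>j\<in>{1..<n}. [:- \<gamma> j, 1:])"
    and sgn_Q: "j \<in> {1..<n} \<Longrightarrow> (-1) ^ (n - j) * poly (map_poly of_int Q) (\<gamma> j) > 0"
begin

abbreviation Qval :: "nat \<Rightarrow> real" where "Qval j \<equiv> poly (map_poly of_int Q) (\<gamma> j)"

definition P :: "int \<Rightarrow> int \<Rightarrow> int poly" where "P T b = scaled n T Q + [:b:]"

definition a :: "nat \<Rightarrow> int" where "a j = (if j = 1 then int n ^ n else 1)"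

text \<open>The integer \<open>a j * Qval j\<close>. For j = 1 it is n^n Q((n-1)/n), expressed
  through \<open>scaled\<close> to avoid fractions.\<close>

definition v :: "nat \<Rightarrow> int" where
  "v j = (if j = 1 then poly (scaled n (int n) Q) (int n - 1) else poly Q (c j))"

lemma a_pos: "a j > 0" using n2 by (simp add: a_def)

lemma of_int_v: "j \<in> {1..<n} \<Longrightarrow> of_int (v j) = of_int (a j) * Qval j"
proof (cases "j = 1")
  case True
  have "real_of_int (v 1) = poly (map_poly of_int (scaled n (int n) Q)) (of_int (int n - 1))"
    unfolding v_def by (simp only: of_int_hom.poly_map_poly if_True simp_thms)
  also have "of_int (int n - 1) = of_int (int n) * \<gamma> 1"
    using n2 crit_1 by simp
  also have "poly (map_poly of_int (scaled n (int n) Q)) (of_int (int n) * \<gamma> 1) = of_int (int n) ^ n * Qval 1"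
    by (rule poly_of_int_scaled) (simp add: deg_Q)
  finally show ?thesis using True by (simp add: a_def)
next
  case False
  assume "j \<in> {1..<n}"
  with False have "\<gamma> j = of_int (c j)" by (intro crit_int) auto
  thus ?thesis using False by (simp add: v_def a_def)
qed

lemma coeff_P: "coeff (P T b) k = (if k = 0 then b else if k \<le> n then coeff Q k * T ^ (n - k) else 0)"
  by (simp add: P_def coeff_scaled Q_0 coeff_pCons split: nat.splits)

lemma degree_P: "degree (P T b) = n" and lead_coeff_P: "lead_coeff (P T b) = 1"
proof -
  have n: "coeff (P T b) n = 1" using lead_Q deg_Q n2 by (simp add: coeff_P)
  show "degree (P T b) = n"
    by (intro antisym degree_le le_degree) (use n in \<open>auto simp: coeff_P\<close>)
  with n show "lead_coeff (P T b) = 1" by simp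
qed

lemma poly_P: "poly (map_poly of_int (P T b)) (of_int T * x) =
    of_int T ^ n * poly (map_poly of_int Q) x + (of_int b :: 'a :: field_char_0)"
  by (simp add: P_def of_int_poly_hom.hom_add poly_of_int_scaled deg_Q of_int_hom.map_poly_pCons_hom)

lemma pderiv_P:
  assumes "T \<noteq> 0"
  shows "map_poly of_int (pderiv (P T b)) = smult (real n) (\<Prod>j\<in>{1..<n}. [:- (of_int T * \<gamma> j), 1:])"
proof (rule poly_ext)
  fix y :: real
  define x where "x = y / of_int T"
  have y: "y = of_int T * x" using assms by (simp add: x_def)
  obtain m where m: "n = Suc m" using n2 by (cases n) auto
  have Tm: "(\<Prod>j\<in>{1..<n}. real_of_int T) = of_int T ^ m" by (simp add: m)
  have "pderiv (P T b) = scaled m T (pderiv Q)"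
    unfolding P_def pderiv_add by (simp add: m pderiv_pCons pderiv_scaled)
  moreover have "degree (pderiv Q) \<le> m" using degree_pderiv[of Q] deg_Q m by simp
  ultimately have "poly (map_poly of_int (pderiv (P T b))) y = of_int T ^ m * poly (map_poly of_int (pderiv Q)) x"
    by (simp add: y poly_of_int_scaled)
  also have "of_int T ^ m * poly (map_poly of_int (pderiv Q)) x = real n * ((\<Prod>j\<in>{1..<n}. of_int T) * (\<Prod>j\<in>{1..<n}. x - \<gamma> j))"
    unfolding pderiv_Q Tm by (simp add: poly_prod mult.left_commute)
  also have "\<dots> = poly (smult (real n) (\<Prod>j\<in>{1..<n}. [:- (of_int T * \<gamma> j), 1:])) y"
    unfolding prod.distrib[symmetric] by (simp add: poly_prod y right_diff_distrib)
  finally show "poly (map_poly of_int (pderiv (P T b))) y =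
     poly (smult (real n) (\<Prod>j\<in>{1..<n}. [:- (of_int T * \<gamma> j), 1:])) y" .
qed

section \<open>Discriminants and real roots in the family\<close>

definition disc_sign :: int where "disc_sign = (-1) ^ (\<Sum>i<n. card {i<..<n})"

lemma form_eq: 
  assumes "j \<in> {1..<n}"
  shows "real_of_int (a j * b + T ^ n * v j) = of_int (a j) * (of_int T ^ n * Qval j + of_int b)"
  using of_int_v[OF assms] by (simp add: algebra_simps)

lemma discriminant_P:
  assumes T: "T \<noteq> 0"
  shows "discriminant (P T b) = disc_sign * (\<Prod>j\<in>{1..<n}. a j * b + T ^ n * v j)"
  unfolding disc_sign_def
proof (rule discriminant_eq_prod_critical_values[where J = "{1..<n}" and \<gamma> = "\<lambda>j. complex_of_real (of_int T * \<gamma> j)"])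
  interpret of_real_poly: map_poly_comm_ring_hom "of_real :: real \<Rightarrow> complex" ..
  have "map_poly of_int (pderiv (P T b)) = map_poly complex_of_real (map_poly of_int (pderiv (P T b)))"
    by (simp add: map_poly_map_poly comp_def)
  also have "\<dots> = smult (of_nat n) (\<Prod>j\<in>{1..<n}. [:- complex_of_real (of_int T * \<gamma> j), 1:])"
    unfolding pderiv_P[OF T] by (simp add: of_real_hom.map_poly_hom_smult of_real_poly.hom_prod)
  finally show "map_poly of_int (pderiv (P T b)) =
    smult (of_nat n) (\<Prod>j\<in>{1..<n}. [:- complex_of_real (of_int T * \<gamma> j), 1:])" .
  have val: "poly (map_poly of_int (P T b)) (complex_of_real x) = of_real (poly (map_poly of_int (P T b)) x)" for x
    by (simp add: map_poly_map_poly comp_def flip: of_real_hom.poly_map_poly)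
  \<comment> \<open>All of n^n goes to the first critical value, the only one with a denominator to
    clear.\<close>
  have "{1..<n} = insert 1 {2..<n}" using n2 by auto
  hence "real n ^ n = (\<Prod>j\<in>{1..<n}. of_int (a j))" by (simp add: a_def)
  hence "real n ^ n * (\<Prod>j\<in>{1..<n}. poly (map_poly of_int (P T b)) (of_int T * \<gamma> j)) =
     (\<Prod>j\<in>{1..<n}. real_of_int (a j) * poly (map_poly of_int (P T b)) (of_int T * \<gamma> j))"
    by (simp add: prod.distrib)
  also have "\<dots> = of_int (\<Prod>j\<in>{1..<n}. a j * b + T ^ n * v j)"
    unfolding of_int_prod by (intro prod.cong refl) (simp only: form_eq poly_P)
  finally have "complex_of_real (real n ^ n * (\<Prod>j\<in>{1..<n}. poly (map_poly of_int (P T b)) (of_int T * \<gamma> j))) =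
     complex_of_real (of_int (\<Prod>j\<in>{1..<n}. a j * b + T ^ n * v j))" by (rule arg_cong)
  thus "of_int (\<Prod>j\<in>{1..<n}. a j * b + T ^ n * v j) =
     complex_of_nat n ^ n * (\<Prod>j\<in>{1..<n}. poly (map_poly of_int (P T b)) (complex_of_real (of_int T * \<gamma> j)))"
    unfolding val by (simp del: of_int_prod)
qed (rule lead_coeff_P degree_P finite_atLeastLessThan | simp)+

lemma num_real_roots_P:
  assumes T: "T > 0" and s: "2 * s \<le> n"
    and A1: "\<And>j. j \<in> {1..<n} \<Longrightarrow> j \<le> 2 * s \<Longrightarrow> (-1) ^ n * (Qval j + of_int b / of_int T ^ n) > 0"
    and A2: "\<And>j. j \<in> {1..<n} \<Longrightarrow> 2 * s < j \<Longrightarrow> (-1) ^ (n - j) * (Qval j + of_int b / of_int T ^ n) > 0"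
  shows "num_real_roots (P T b) = n - 2 * s"
  unfolding num_real_roots_def
proof (rule card_real_roots_of_critical_signs[where g = "\<lambda>j. of_int T * \<gamma> j"])
  have val: "poly (map_poly of_int (P T b)) (of_int T * \<gamma> j) = of_int T ^ n * (Qval j + of_int b / of_int T ^ n)" for j
    using T by (simp add: poly_P algebra_simps)
  have Tn: "real_of_int T ^ n > 0" using T by simp
  show "(-1) ^ n * poly (map_poly of_int (P T b)) (of_int T * \<gamma> j) > 0" if "1 \<le> j" "j < n" "j \<le> 2 * s" for j
    using mult_pos_pos[OF Tn A1[of j]] that unfolding val by (simp add: mult.left_commute)
  show "(-1) ^ (n - j) * poly (map_poly of_int (P T b)) (of_int T * \<gamma> j) > 0" if "2 * s < j" "j < n" for j
    using mult_pos_pos[OF Tn A2[of j]] that unfolding val by (simp add: mult.left_commute)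
  show "\<exists>j\<in>{1..<n}. x = of_int T * \<gamma> j" if "poly (pderiv (map_poly of_int (P T b))) x = 0" for x
  proof -
    have "poly (smult (real n) (\<Prod>j\<in>{1..<n}. [:- (of_int T * \<gamma> j), 1:])) x = 0"
      using that pderiv_P[of T b] T by (simp add: of_int_hom.map_poly_pderiv)
    thus ?thesis using n2 by (auto simp: poly_prod)
  qed
  show "of_int T * \<gamma> i < of_int T * \<gamma> j" if "1 \<le> i" "i < j" "j < n" for i j
    using crit_less[of j i] T that by simp
  show "lead_coeff (map_poly real_of_int (P T b)) > 0" using lead_coeff_P[of T b] by simp
qed (use n2 s in \<open>simp_all add: degree_P\<close>)

text \<open>The critical values of \<open>Q\<close> alternate in sign and grow in absolute value. A
  shift by (-1)^n times a number between the absolute values of index 2s and 2s + 1 overrides the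
  signs of the first 2s values and leaves the later ones unchanged.\<close>

lemma root_count_window:
  assumes s: "2 * s \<le> n"
  shows "\<exists>u w. u < w \<and> (\<forall>\<beta>. u < \<beta> \<and> \<beta> < w \<longrightarrow>
     (\<forall>j\<in>{1..<n}. (j \<le> 2 * s \<longrightarrow> (-1) ^ n * (Qval j + \<beta>) > 0) \<and>
                   (2 * s < j \<longrightarrow> (-1) ^ (n - j) * (Qval j + \<beta>) > 0)))"
proof -
  define h where "h = (\<lambda>j. \<bar>Qval j\<bar>)"
  \<comment> \<open>The default 0 serves s = 0, and the default \<open>x + 1\<close> in
    \<open>y\<close> serves the case that no index exceeds 2s.\<close>
  define x where "x = Max (insert 0 (h ` {j\<in>{1..<n}. j \<le> 2 * s}))"
  define y where "y = Min (insert (x + 1) (h ` {j\<in>{1..<n}. 2 * s < j}))"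
  have x_le: "h j \<le> x" if "j \<in> {1..<n}" "j \<le> 2 * s" for j unfolding x_def by (rule Max_ge) (use that in auto)
  have le_y: "y \<le> h j" if "j \<in> {1..<n}" "2 * s < j" for j unfolding y_def by (rule Min_le) (use that in auto)
  have pos: "h j > 0" if "j \<in> {1..<n}" for j using sgn_Q[OF that] by (auto simp: h_def)
  have "x < h j" if "j \<in> {1..<n}" "2 * s < j" for j
    unfolding x_def using that pos[of j] abs_less[of j] by (subst Max_less_iff) (auto simp: h_def)
  hence xy: "x < y" unfolding y_def by (subst Min_gr_iff) auto
  have sgn: "Qval j = (-1) ^ (n - j) * h j" if "j \<in> {1..<n}" for j
    using sgn_Q[OF that] by (cases "even (n - j)") (auto simp: h_def)
  have main: "(j \<le> 2 * s \<longrightarrow> (-1) ^ n * (Qval j + (-1) ^ n * \<beta>) > 0) \<and>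
              (2 * s < j \<longrightarrow> (-1) ^ (n - j) * (Qval j + (-1) ^ n * \<beta>) > 0)"
    if \<beta>: "x < \<beta>" "\<beta> < y" and j: "j \<in> {1..<n}" for \<beta> j
  proof (intro conjI impI)
    assume js: "j \<le> 2 * s"
    have "h j < \<beta>" using x_le[OF j js] \<beta> by linarith
    thus "(-1) ^ n * (Qval j + (-1) ^ n * \<beta>) > 0" using pos[OF j]
      by (simp add: sgn[OF j] minus_one_power_iff)
  next
    assume js: "2 * s < j"
    have "\<beta> < h j" using le_y[OF j js] \<beta> by linarith
    moreover have "0 \<le> x" unfolding x_def by (rule Max_ge) auto
    hence "\<beta> > 0" using \<beta> by linarith
    ultimately show "(-1) ^ (n - j) * (Qval j + (-1) ^ n * \<beta>) > 0"
      by (simp add: sgn[OF j] minus_one_power_iff)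
  qed
  show ?thesis
  proof (cases "even n")
    case True
    thus ?thesis using main xy by (intro exI[of _ x] exI[of _ y]) auto
  next
    case False
    \<comment> \<open>For odd \<open>n\<close> the shift is negative, so the window is
      reflected.\<close>
    have "(j \<le> 2 * s \<longrightarrow> (-1) ^ n * (Qval j + \<beta>) > 0) \<and>
              (2 * s < j \<longrightarrow> (-1) ^ (n - j) * (Qval j + \<beta>) > 0)"
      if "-y < \<beta>" "\<beta> < -x" "j \<in> {1..<n}" for \<beta> j
      using main[of "-\<beta>" j] that False by simp
    thus ?thesis using xy by (intro exI[of _ "-y"] exI[of _ "-x"]) auto
  qed
qed

end

section \<open>Local conditions\<close>

lemma dvd_poly_of_coeff_0:
  fixes R :: "int poly"
  assumes "coeff R 0 = 0"
  shows "x dvd poly R x"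
  using assms by (cases R) simp

text \<open>Pigeonhole: otherwise choosing for every residue a form that vanishes there would inject
  \<open>p\<close> residues into \<open>J\<close>.\<close>

lemma exists_avoiding_residue:
  fixes F :: "'a \<Rightarrow> int \<Rightarrow> int"
  assumes "finite J" "card J < p"
    and inj: "\<And>j x y. j \<in> J \<Longrightarrow> int p dvd F j x \<Longrightarrow> int p dvd F j y \<Longrightarrow> int p dvd x - y"
  shows "\<exists>x. \<forall>j\<in>J. \<not> int p dvd F j x"
proof (rule ccontr)
  assume "\<not> ?thesis"
  then obtain f where f: "\<And>x. f x \<in> J \<and> int p dvd F (f x) x" by metis
  have "inj_on f {0..<int p}"
  proof (rule inj_onI)
    fix x y assume xy: "x \<in> {0..<int p}" "y \<in> {0..<int p}" "f x = f y"
    hence "int p dvd x - y" using inj[of "f x" x y] f[of x] f[of y] by simp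
    thus "x = y" using xy(1,2) by (metis atLeastLessThan_iff mod_eq_dvd_iff mod_pos_pos_trivial)
  qed
  hence "card {0..<int p} \<le> card J" using f assms(1) by (intro card_inj_on_le) auto
  thus False using assms(2) by simp
qed

text \<open>\<open>q\<close> is the product of one auxiliary prime for each prime factor of
  \<open>n\<close>. Coprimality to \<open>n\<close> keeps the slopes \<open>a j\<close> invertible
  modulo the primes dividing \<open>q\<close>.\<close>

lemma exists_modulus_with_prime_cong_1:
  assumes n: "n \<ge> (2 :: nat)"
  shows "\<exists>q \<ge> 2. coprime q n \<and>
           (\<forall>p. prime p \<longrightarrow> p dvd n \<longrightarrow> (\<exists>l. prime l \<and> l dvd q \<and> p ^ multiplicity p n dvd l - 1))"
proof -
  have "\<exists>l. prime l \<and> coprime l n \<and> p ^ multiplicity p n dvd l - 1" if "p \<in> prime_factors n" for p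
  proof (rule exists_prime_cong_1_mod_prime_power)
    show "multiplicity p n > 0" using that by (simp add: prime_factors_multiplicity)
  qed (use that n in \<open>auto simp: in_prime_factors_iff\<close>)
  then obtain l where l: "\<And>p. p \<in> prime_factors n \<Longrightarrow> prime (l p) \<and> coprime (l p) n \<and> p ^ multiplicity p n dvd l p - 1"
    by metis
  define q where "q = (\<Prod>p\<in>prime_factors n. l p)"
  have dv: "l p dvd q" if "p \<in> prime_factors n" for p
    unfolding q_def using that by (intro dvd_prodI) auto
  obtain p where p: "prime p" "p dvd n" using n prime_factor_nat[of n] by auto
  hence pf: "p \<in> prime_factors n" using n by (simp add: in_prime_factors_iff)
  have "q > 0" unfolding q_def using l by (intro prod_pos) (auto simp: prime_gt_0_nat)
  hence "l p \<le> q" using dv[OF pf] by (rule dvd_imp_le[rotated])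
  moreover have "l p \<ge> 2" using l[OF pf] prime_ge_2_nat by blast
  ultimately have "q \<ge> 2" by simp
  moreover have "coprime q n" unfolding q_def by (intro prod_coprime_left) (use l in auto)
  ultimately show ?thesis using l dv n by (intro exI[of _ q]) (auto simp: in_prime_factors_iff)
qed

lemma sqrt_le_linear_eventually:
  fixes A B :: real
  assumes "A > 0" "B \<ge> 0"
  shows "\<exists>X0. \<forall>X\<ge>X0. 1 + B * sqrt X \<le> A * X"
proof (intro exI allI impI)
  fix X assume X: "X \<ge> (max 1 ((1 + B) / A))\<^sup>2"
  define y where "y = sqrt X"
  have "X \<ge> 0" using X by (meson order_trans zero_le_power2)
  hence Xy: "X = y\<^sup>2" by (simp add: y_def)
  have y: "y \<ge> max 1 ((1 + B) / A)" unfolding y_def using X by (intro real_le_rsqrt) 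
  hence "1 + B \<le> A * y" using assms by (simp add: field_simps)
  hence "(1 + B) * y \<le> A * y * y" using y by (intro mult_right_mono) auto
  moreover have "1 + B * y \<le> (1 + B) * y" using y by (simp add: algebra_simps)
  moreover have "A * y * y = A * X" by (subst Xy) (simp add: power2_eq_square)
  ultimately have "1 + B * y \<le> A * X" by linarith
  thus "1 + B * sqrt X \<le> A * X" by (simp only: y_def)
qed

context seed
begin

text \<open>Every coefficient strictly between the constant and the leading one carries a positive
  power of \<open>T\<close>.\<close>

lemma P_cong:
  assumes "l dvd T" "l dvd b + g"
  shows "\<exists>h. P T b = monom 1 n - [:g:] + smult l h"
proof -
  have "l dvd coeff (P T b - (monom 1 n - [:g:])) k" for k
  proof -
    consider "k = 0" | "0 < k" "k < n" | "k = n" | "k > n" by linarith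
    thus ?thesis
    proof cases
      case 2
      hence "T dvd T ^ (n - k)" by (intro dvd_power) auto
      hence "l dvd T ^ (n - k)" using assms(1) dvd_trans by blast
      thus ?thesis using 2 by (simp add: coeff_P coeff_pCons split: nat.splits)
    next
      case 3
      thus ?thesis using lead_coeff_P[of T b] n2 by (simp add: degree_P coeff_pCons split: nat.splits)
    qed (use assms(2) n2 in \<open>auto simp: coeff_P coeff_pCons split: nat.splits\<close>)
  qed
  hence "[:l:] dvd P T b - (monom 1 n - [:g:])" by (simp add: const_poly_dvd_iff)
  then obtain h where "P T b - (monom 1 n - [:g:]) = [:l:] * h" by (elim dvdE)
  thus ?thesis by (intro exI[of _ h]) (simp add: algebra_simps)
qed

lemma v_1: "v 1 = poly (P (int n) 0) (int n - 1)"
  by (simp add: v_def P_def)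

lemma v_1_cong:
  assumes "p dvd int n"
  shows "[v 1 = (int n - 1) ^ n] (mod p)"
proof -
  obtain h where "P (int n) 0 = monom 1 n - [:0:] + smult p h" using P_cong[of p "int n" 0 0] assms by auto
  hence "v 1 = (int n - 1) ^ n + p * poly h (int n - 1)" unfolding v_1 by (simp add: poly_monom)
  thus ?thesis by (simp only: cong_iff_dvd_diff add_diff_cancel_left' dvd_triv_left)
qed

text \<open>The constant term vanishes, so the argument divides the value. For odd \<open>n\<close>
  this makes \<open>v 1\<close> even, which settles the prime 2.\<close>

lemma v_1_dvd: "int n - 1 dvd v 1"
  unfolding v_1 by (rule dvd_poly_of_coeff_0) (simp add: coeff_P)

lemma dvd_v:
  assumes "j \<in> {2..<n}" "prime p" "p \<le> n"
  shows "int p dvd v j"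
proof -
  have "p dvd fact n" using assms prime_dvd_fact_iff by blast
  hence "int p dvd int (fact n)" by (simp only: int_dvd_int_iff)
  hence "int p dvd c j" using fact_dvd[OF assms(1)] by (metis dvd_trans of_nat_fact)
  also have "c j dvd poly Q (c j)" by (rule dvd_poly_of_coeff_0) (rule Q_0)
  finally show ?thesis using assms(1) by (simp add: v_def)
qed

lemma coprime_a: "prime p \<Longrightarrow> \<not> p dvd n \<Longrightarrow> coprime (int p) (a j)"
  by (simp add: a_def prime_imp_coprime)

text \<open>For \<open>p \<le> n\<close> all forms with \<open>j \<ge> 2\<close> reduce to \<open>b\<close>, so at most two residues are bad
  (and \<open>b = 1\<close> works if \<open>p = 2\<close> or \<open>p\<close> divides \<open>n\<close>); for
  \<open>p > n\<close> there are fewer forms than residues.\<close>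

lemma local_residue:
  assumes p: "prime p" and pT: "\<not> int p dvd T"
  shows "\<exists>b. \<forall>j\<in>{1..<n}. \<not> int p dvd a j * b + T ^ n * v j"
proof -
  have p2: "p \<ge> 2" using p by (rule prime_ge_2_nat)
  have not1: "\<not> int p dvd 1" using p2 by (simp add: zdvd1_eq)
  have rest: "\<not> int p dvd a j * 1 + T ^ n * v j" if "p \<le> n" "j \<in> {2..<n}" for j
    using dvd_v[OF that(2) p that(1)] that not1 by (simp add: a_def dvd_add_left_iff)
  have split: "{1..<n} = insert 1 {2..<n}" using n2 by auto
  consider "p dvd n" | "\<not> p dvd n" "p = 2" | "\<not> p dvd n" "2 < p" "p \<le> n" | "\<not> p dvd n" "p > n"
    using p2 by linarith
  thus ?thesis
  proof cases
    case 1
    \<comment> \<open>Here \<open>a 1\<close> vanishes modulo \<open>p\<close>, while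
      \<open>v 1\<close> is (n-1)^n and hence a unit; the first form is a unit for every b.\<close>
    hence pn: "int p dvd int n" by simp
    have "int n - (int n - 1) = 1" by simp
    hence "\<not> int p dvd int n - 1" using pn not1 dvd_diff[of "int p" "int n" "int n - 1"] by auto
    hence "\<not> int p dvd (int n - 1) ^ n" using p prime_dvd_power[of "int p"] by auto
    hence "\<not> int p dvd v 1" using v_1_cong[OF pn] cong_dvd_iff by blast
    hence "\<not> int p dvd T ^ n * v 1" using p pT prime_dvd_power[of "int p"] by (auto simp: prime_dvd_mult_iff)
    moreover have "int n dvd int n ^ n" using n2 by (intro dvd_power) auto
    hence "int p dvd int n ^ n" using pn dvd_trans by blast
    hence "int p dvd a 1 * 1" by (simp add: a_def)
    ultimately have "\<not> int p dvd a 1 * 1 + T ^ n * v 1" by (simp add: dvd_add_right_iff)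
    moreover have "p \<le> n" using 1 n2 by (intro dvd_imp_le) auto
    ultimately show ?thesis using rest unfolding split by (intro exI[of _ 1]) blast
  next
    case 2
    have "even (int n - 1)" using 2 by simp
    hence "even (v 1)" using v_1_dvd dvd_trans by blast
    hence "odd (a 1 * 1 + T ^ n * v 1)" using 2 by (simp add: a_def)
    hence "\<not> int p dvd a 1 * 1 + T ^ n * v 1" using 2 by simp
    thus ?thesis using rest 2 n2 unfolding split by (intro exI[of _ 1]) auto
  next
    case 3
    \<comment> \<open>Index 0 stands for the common reduction b of all forms with j \<ge> 2. Two
      forms cannot exhaust p > 2 residues.\<close>
    define F where "F = (\<lambda>j b. if j = (0::nat) then b else a 1 * b + T ^ n * v 1)"
    have "\<exists>b. \<forall>j\<in>{0, 1}. \<not> int p dvd F j b"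
    proof (rule exists_avoiding_residue)
      fix j :: nat and x y
      assume "int p dvd F j x" "int p dvd F j y"
      hence "int p dvd F j x - F j y" by (rule dvd_diff)
      hence "int p dvd (if j = 0 then 1 else a 1) * (x - y)" by (simp add: F_def algebra_simps split: if_splits)
      thus "int p dvd x - y" using coprime_a[OF p 3(1), of 1] by (auto simp: coprime_dvd_mult_right_iff split: if_splits)
    qed (use 3 in auto)
    then obtain b where b: "\<not> int p dvd b" "\<not> int p dvd a 1 * b + T ^ n * v 1" by (auto simp: F_def)
    have "\<not> int p dvd a j * b + T ^ n * v j" if "j \<in> {2..<n}" for j
      using dvd_v[OF that p 3(3)] that b(1) by (simp add: a_def dvd_add_left_iff)
    thus ?thesis using b(2) unfolding split by blast
  next
    case 4
    show ?thesis
    proof (rule exists_avoiding_residue)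
      fix j x y
      assume "int p dvd a j * x + T ^ n * v j" "int p dvd a j * y + T ^ n * v j"
      hence "int p dvd (a j * x + T ^ n * v j) - (a j * y + T ^ n * v j)" by (rule dvd_diff)
      hence "int p dvd a j * (x - y)" by (simp add: algebra_simps)
      thus "int p dvd x - y" using coprime_a[OF p 4(1), of j] by (simp add: coprime_dvd_mult_right_iff)
    qed (use 4 in auto)
  qed
qed

lemma not_dvd_form_of_dvd:
  assumes "prime p" "int p dvd T" "\<not> p dvd n" "\<not> int p dvd b"
  shows "\<not> int p dvd a j * b + T ^ n * v j"
proof -
  have "T dvd T ^ n" using n2 by (intro dvd_power) auto
  hence "int p dvd T ^ n * v j" using assms(2) by (meson dvd_mult2 dvd_trans)
  moreover have "\<not> int p dvd a j * b" using coprime_a[OF assms(1,3), of j] assms(4)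
    by (simp add: coprime_dvd_mult_right_iff)
  ultimately show ?thesis by (simp add: dvd_add_left_iff)
qed

lemma irreducible_P:
  fixes q :: nat and T :: int
  assumes "int q dvd T"
    and q: "\<And>p. prime p \<Longrightarrow> p dvd n \<Longrightarrow> \<exists>l. prime l \<and> l dvd q \<and> p ^ multiplicity p n dvd l - 1"
    and g: "\<And>l. prime l \<Longrightarrow> l dvd q \<Longrightarrow> residue_primroot l (g l) \<and> [b = - int (g l)] (mod int l)"
  shows "irreducible (P T b)"
proof (rule irreducible_int_poly_of_primroots[OF lead_coeff_P degree_P])
  fix p :: nat assume "prime p" "p dvd n"
  then obtain l where l: "prime l" "l dvd q" "p ^ multiplicity p n dvd l - 1" using q by blast
  have "int l dvd T" using l(2) assms(1) by (meson dvd_trans int_dvd_int_iff)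
  moreover have "int l dvd b + int (g l)" using g[OF l(1,2)] by (simp add: cong_iff_dvd_diff)
  ultimately obtain h where "P T b = monom 1 n - [:int (g l):] + smult (int l) h" using P_cong by blast
  thus "\<exists>l c h. prime l \<and> residue_primroot l c \<and> p ^ multiplicity p n dvd l - 1 \<and>
      P T b = monom 1 n - [:int c:] + smult (int l) h" using l g[OF l(1,2)] by blast
qed (use n2 in auto)

end

section \<open>Counting\<close>

lemma exists_int_cong_at_primes:
  fixes U :: "nat \<Rightarrow> int"
  assumes "finite A" "\<And>p. p \<in> A \<Longrightarrow> prime p"
  shows "\<exists>x :: int. \<forall>p\<in>A. [x = U p] (mod int p)"
proof -
  have "\<forall>p\<in>A. \<forall>r\<in>A. p \<noteq> r \<longrightarrow> coprime p r" using assms(2) primes_coprime by blast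
  from chinese_remainder_nat[OF assms(1), of "\<lambda>p. p", OF this, of "\<lambda>p. nat (U p mod int p)"]
  obtain x where x: "\<And>p. p \<in> A \<Longrightarrow> [x = nat (U p mod int p)] (mod p)" by blast
  have "[int x = U p] (mod int p)" if p: "p \<in> A" for p
  proof -
    have "p > 0" using assms(2)[OF p] prime_gt_0_nat by blast
    hence "int (nat (U p mod int p)) = U p mod int p" by simp
    moreover have "[int x = int (nat (U p mod int p))] (mod int p)" using x[OF p] by (simp only: cong_int_iff)
    ultimately show ?thesis by (simp add: cong_def)
  qed
  thus ?thesis by blast
qed

context seed
begin

text \<open>The sieve is run for T = q^k, with b of size X = T^n. The window, the sieve bound
  \<open>z\<close> and the modulus \<open>W\<close> are fixed before \<open>k\<close>, so
  \<open>C\<close> and \<open>\<kappa>\<close> are uniform; only the residue class \<open>b0\<close>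
  varies with \<open>k\<close>.\<close>

lemma many_good_polynomials:
  assumes s: "2 * s \<le> n" and S: "finite S" "\<And>p. p \<in> S \<Longrightarrow> prime p"
  shows "\<exists>(q :: nat) C \<kappa> k0. q \<ge> 2 \<and> C > 0 \<and> \<kappa> > 0 \<and>
    (\<forall>k\<ge>k0. \<exists>G. finite G \<and> \<kappa> * real (q ^ n) ^ k \<le> real (card G) \<and>
      (\<forall>b\<in>G. irreducible (P (int q ^ k) b) \<and> num_real_roots (P (int q ^ k) b) = n - 2 * s \<and>
        squarefree (discriminant (P (int q ^ k) b)) \<and>
        (\<forall>p\<in>S. \<not> int p dvd discriminant (P (int q ^ k) b)) \<and>
        real_of_int \<bar>discriminant (P (int q ^ k) b)\<bar> \<le> (C * real (q ^ n) ^ k) ^ (n - 1)))"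
proof -
  let ?I = "{1..<n}"
  obtain q where q2: "q \<ge> 2" and qn: "coprime q n" and
    ql: "\<And>p. prime p \<Longrightarrow> p dvd n \<Longrightarrow> \<exists>l. prime l \<and> l dvd q \<and> p ^ multiplicity p n dvd l - 1"
    using exists_modulus_with_prime_cong_1[OF n2] by blast
  have "\<exists>g. residue_primroot l g" if "prime l" for l :: nat
    using prime_primitive_root_exists[of l] that prime_gt_1_nat by blast
  then obtain g where g: "\<And>l::nat. prime l \<Longrightarrow> residue_primroot l (g l)" by metis
  obtain u w where uw: "u < w" and win: "\<And>\<beta> j. u < \<beta> \<Longrightarrow> \<beta> < w \<Longrightarrow> j \<in> ?I \<Longrightarrow>
       (j \<le> 2 * s \<longrightarrow> (-1) ^ n * (Qval j + \<beta>) > 0) \<and> (2 * s < j \<longrightarrow> (-1) ^ (n - j) * (Qval j + \<beta>) > 0)"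
    using root_count_window[OF s] by blast
  \<comment> \<open>Eliminating b from forms \<open>i\<close> and \<open>j\<close> leaves T^n times
    \<open>D i j\<close>, so a prime dividing both divides \<open>q\<close> or \<open>D i j\<close>.
    It is nonzero because critical values of \<open>Q\<close> differ in absolute value.\<close>
  define D where "D = (\<lambda>i j. a j * v i - a i * v j)"
  have D0: "D i j \<noteq> 0" if "i \<in> ?I" "j \<in> ?I" "i \<noteq> j" for i j
  proof -
    have ne: "Qval i \<noteq> Qval j"
      using abs_less[of i j] abs_less[of j i] that by (cases "i < j") force+
    have "real_of_int (D i j) = of_int (a i) * of_int (a j) * (Qval i - Qval j)"
      using of_int_v[OF that(1)] of_int_v[OF that(2)] by (simp add: D_def algebra_simps)
    thus ?thesis using ne a_pos[of i] a_pos[of j] by auto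
  qed
  \<comment> \<open>\<open>z\<close> dominates q, the primes in \<open>S\<close> and all
    \<open>D i j\<close>, so that beyond it no prime divides two forms. The summand 2n makes the
    total loss from the len/z terms at most half.\<close>
  define z where "z = 2 * n + q + (\<Sum>i\<in>?I. \<Sum>j\<in>?I. nat \<bar>D i j\<bar>) + (\<Sum>p\<in>S. p)"
  have zD: "nat \<bar>D i j\<bar> \<le> z" if "i \<in> ?I" "j \<in> ?I" for i j
  proof -
    have "nat \<bar>D i j\<bar> \<le> (\<Sum>j\<in>?I. nat \<bar>D i j\<bar>)" using that by (intro member_le_sum) auto
    also have "\<dots> \<le> (\<Sum>i\<in>?I. \<Sum>j\<in>?I. nat \<bar>D i j\<bar>)"
      using that by (intro member_le_sum[of i ?I "\<lambda>i. \<Sum>j\<in>?I. nat \<bar>D i j\<bar>"]) auto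
    finally show ?thesis by (simp add: z_def)
  qed
  have zS: "p \<le> z" if "p \<in> S" for p
    using member_le_sum[of p S "\<lambda>p. p"] that S(1) by (simp add: z_def)
  have zn: "2 * n \<le> z" and zq: "q \<le> z" by (simp_all add: z_def)
  define A where "A = {p. prime p \<and> p \<le> z}"
  have finA: "finite A" unfolding A_def by (rule finite_subset[of _ "{..z}"]) auto
  define W where "W = (\<Prod>p\<in>A. p)"
  have W0: "W > 0" unfolding W_def by (intro prod_pos) (auto simp: A_def prime_gt_0_nat)
  define C where "C = real n ^ n * (\<bar>u\<bar> + \<bar>w\<bar> + (\<Sum>j\<in>?I. \<bar>Qval j\<bar>) + 1)"
  have C0: "C > 0" unfolding C_def using n2 by (intro mult_pos_pos add_nonneg_pos add_nonneg_nonneg sum_nonneg) auto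
  \<comment> \<open>The progression has about 4 \<kappa> X members; the sieve loses at most 2
    \<kappa> X to the main error and \<kappa> X to the square-root error, leaving \<kappa>
    X.\<close>
  define \<kappa> where "\<kappa> = (w - u) / (4 * real W)"
  have \<kappa>0: "\<kappa> > 0" using uw W0 by (simp add: \<kappa>_def)
  obtain X0 where X0: "\<And>X. X \<ge> X0 \<Longrightarrow> 1 + real (n - 1) * sqrt C * sqrt X \<le> \<kappa> * X"
    using sqrt_le_linear_eventually[OF \<kappa>0, of "real (n - 1) * sqrt C"] C0 by auto
  \<comment> \<open>At least 1, so that \<open>q\<close> divides \<open>T\<close>.\<close>
  define k0 where "k0 = max 1 (nat \<lceil>X0\<rceil>)"
  have main: "\<exists>G. finite G \<and> \<kappa> * real (q ^ n) ^ k \<le> real (card G) \<and>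
      (\<forall>b\<in>G. irreducible (P (int q ^ k) b) \<and> num_real_roots (P (int q ^ k) b) = n - 2 * s \<and>
        squarefree (discriminant (P (int q ^ k) b)) \<and>
        (\<forall>p\<in>S. \<not> int p dvd discriminant (P (int q ^ k) b)) \<and>
        real_of_int \<bar>discriminant (P (int q ^ k) b)\<bar> \<le> (C * real (q ^ n) ^ k) ^ (n - 1))"
    if k: "k \<ge> k0" for k
  proof -
    define T where "T = int q ^ k"
    define X where "X = real (q ^ n) ^ k"
    have k1: "k \<ge> 1" using k by (simp add: k0_def)
    have T0: "T > 0" using q2 by (simp add: T_def)
    have qT: "int q dvd T" unfolding T_def using k1 by (intro dvd_power) auto
    have XT: "X = of_int T ^ n" by (simp add: X_def T_def mult.commute flip: power_mult)
    have Xpos: "X > 0" using T0 by (simp add: XT)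
    have "X0 \<le> real k" using k unfolding k0_def by linarith
    also have "k \<le> (q ^ n) ^ k"
    proof -
      have "2 \<le> q ^ n" using q2 n2 self_le_power[of q n] by linarith
      hence "2 ^ k \<le> (q ^ n) ^ k" by (rule power_mono) simp
      thus ?thesis using less_exp[of k] by linarith
    qed
    hence "real k \<le> X" unfolding X_def by (simp only: of_nat_le_iff flip: of_nat_power)
    finally have XX0: "X \<ge> X0" .
    define F where "F = (\<lambda>j b. a j * b + T ^ n * v j)"
    have F_app: "a j * b + T ^ n * v j = F j b" for j b by (simp add: F_def)
    \<comment> \<open>At primes dividing \<open>q\<close> the class is dictated by the primitive
      root needed for irreducibility, and it also avoids the zeros of all forms. At the other primes
      \<open>T\<close> is a unit and any admissible class will do.\<close>
    have "\<exists>U. (\<forall>j\<in>?I. \<not> int p dvd F j U) \<and> (p dvd q \<longrightarrow> [U = - int (g p)] (mod int p))" if p: "prime p" for p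
    proof (cases "p dvd q")
      case True
      have "\<not> p dvd n" using coprime_common_divisor[OF qn True] p not_prime_unit by blast
      moreover have "int p dvd T" using True qT by (meson dvd_trans int_dvd_int_iff)
      moreover have "coprime p (g p)" using g[OF p] by (simp add: residue_primroot_def)
      hence "\<not> p dvd g p" using p by (metis coprime_absorb_left not_prime_unit)
      hence "\<not> int p dvd - int (g p)" by simp
      ultimately show ?thesis using not_dvd_form_of_dvd[OF p, of T "- int (g p)"]
        by (intro exI[of _ "- int (g p)"]) (auto simp: F_def)
    next
      case False
      have "\<not> int p dvd T" using False p by (auto simp: T_def dest: prime_dvd_power simp flip: of_nat_power)
      from local_residue[OF p this] False show ?thesis by (auto simp: F_def)
    qed
    then obtain U where U: "\<And>p j. prime p \<Longrightarrow> j \<in> ?I \<Longrightarrow> \<not> int p dvd F j (U p)"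
      "\<And>p. prime p \<Longrightarrow> p dvd q \<Longrightarrow> [U p = - int (g p)] (mod int p)" by metis
    obtain b0 where b0: "\<And>p. p \<in> A \<Longrightarrow> [b0 = U p] (mod int p)"
      using exists_int_cong_at_primes[OF finA, of U] by (auto simp: A_def)
    define B where "B = {b. u * X < of_int b \<and> of_int b < w * X \<and> [b = b0] (mod int W)}"
    define G where "G = {b \<in> B. squarefree (\<Prod>j\<in>?I. a j * b + T ^ n * v j)}"
    have BU: "[b = U p] (mod int p)" if "b \<in> B" "prime p" "p \<le> z" for b p
    proof -
      have pA: "p \<in> A" using that by (simp add: A_def)
      hence "p dvd W" unfolding W_def using finA by (intro dvd_prodI) auto
      hence "[b = b0] (mod int p)" using that(1) cong_dvd_modulus[of b b0 "int W" "int p"] by (simp add: B_def)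
      thus ?thesis using b0[OF pA] cong_trans by blast
    qed
    have Bwin: "u < of_int b / of_int T ^ n" "of_int b / of_int T ^ n < w" if "b \<in> B" for b
      using that Xpos by (auto simp: B_def XT field_simps)
    have Freal: "real_of_int (F j b) = of_int (a j) * X * (Qval j + of_int b / of_int T ^ n)" if "j \<in> ?I" for j b
      using form_eq[OF that, of b T] T0 by (simp add: F_def XT field_simps)
    have Fnz: "F j b \<noteq> 0" if "j \<in> ?I" "b \<in> B" for j b
    proof -
      have "Qval j + of_int b / of_int T ^ n \<noteq> 0" using win[OF Bwin[OF that(2)] that(1)] by (cases "j \<le> 2 * s") force+
      thus ?thesis using Freal[OF that(1), of b] Xpos a_pos[of j] by auto
    qed
    have Fle: "real_of_int \<bar>F j b\<bar> \<le> C * X" if "j \<in> ?I" "b \<in> B" for j b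
    proof -
      let ?\<beta> = "of_int b / of_int T ^ n :: real"
      have 1: "\<bar>?\<beta>\<bar> \<le> \<bar>u\<bar> + \<bar>w\<bar>" using Bwin[OF that(2)] by linarith
      have 2: "\<bar>Qval j\<bar> \<le> (\<Sum>j\<in>?I. \<bar>Qval j\<bar>)" using that by (intro member_le_sum) auto
      have "real_of_int \<bar>F j b\<bar> = of_int (a j) * (X * \<bar>Qval j + ?\<beta>\<bar>)"
        using Freal[OF that(1), of b] a_pos[of j] Xpos by (simp add: abs_mult)
      also have "\<dots> \<le> real n ^ n * (X * (\<bar>u\<bar> + \<bar>w\<bar> + (\<Sum>j\<in>?I. \<bar>Qval j\<bar>) + 1))"
      proof (intro mult_mono mult_left_mono)
        show "\<bar>Qval j + ?\<beta>\<bar> \<le> \<bar>u\<bar> + \<bar>w\<bar> + (\<Sum>j\<in>?I. \<bar>Qval j\<bar>) + 1" using 1 2 by linarith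
      qed (use Xpos n2 in \<open>auto simp: a_def\<close>)
      finally show ?thesis by (simp add: C_def mult_ac)
    qed
    have Fsmall: "\<not> int p dvd F j b" if "j \<in> ?I" "b \<in> B" "prime p" "p \<le> z" for j b p
    proof -
      have "[F j b = F j (U p)] (mod int p)" unfolding F_def
        using BU[OF that(2-4)] by (intro cong_add cong_mult) auto
      thus ?thesis using U(1)[OF that(3,1)] cong_dvd_iff by blast
    qed
    have big: "\<not> p dvd n" "\<not> p dvd q" if "prime p" "p > z" for p
      using that zn zq n2 q2 by (auto dest: dvd_imp_le)
    have card: "real (card G) \<ge> (w * X - u * X) / of_int (int W) - 1 -
        real (card ?I) * ((w * X - u * X) / (of_int (int W) * real z) + sqrt \<bar>C * X\<bar>)"
      unfolding G_def B_def
    proof (rule card_squarefree_values_ge, unfold B_def[symmetric] F_app)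
      show "u * X \<le> w * X" using uw Xpos by simp
      show "z > 0" using zn n2 by simp
    next
      fix i :: nat and p :: nat assume p: "prime p" "z < p"
      have "coprime (int p) (int W)"
        unfolding W_def of_nat_prod
        by (intro prod_coprime_right) (use p in \<open>auto simp: A_def primes_coprime\<close>)
      thus "coprime (int p) (a i) \<and> coprime (int p) (int W)" using coprime_a[OF p(1) big(1)[OF p]] by simp
    next
      fix i j b p assume ij: "i \<in> ?I" "j \<in> ?I" "i \<noteq> j" and b: "b \<in> B" and p: "prime p" "z < p"
        and dv: "int p dvd F i b"
      show "\<not> int p dvd F j b"
      proof
        assume "int p dvd F j b"
        hence "int p dvd a j * F i b - a i * F j b" using dv by (intro dvd_diff dvd_mult)
        also have "a j * F i b - a i * F j b = T ^ n * D i j" by (simp add: F_def D_def algebra_simps)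
        finally have "int p dvd T ^ n \<or> int p dvd D i j" using p(1) by (simp add: prime_dvd_mult_iff)
        moreover have "\<not> int p dvd T ^ n"
          using big(2)[OF p] p(1) by (auto simp: T_def dest!: prime_dvd_power simp flip: of_nat_power power_mult)
        ultimately have "int p \<le> \<bar>D i j\<bar>" using D0[OF ij] by (intro zdvd_imp_le) auto
        thus False using zD[OF ij(1,2)] p(2) by linarith
      qed
    qed (use W0 Fnz Fle Fsmall in auto)
    have "(w * X - u * X) / of_int (int W) = 4 * (\<kappa> * X)" using W0 by (simp add: \<kappa>_def field_simps)
    moreover have "(w * X - u * X) / (of_int (int W) * real z) = 4 * (\<kappa> * X) / real z"
      using W0 zn n2 by (simp add: \<kappa>_def field_simps)
    moreover have "sqrt \<bar>C * X\<bar> = sqrt C * sqrt X" using C0 Xpos by (simp add: real_sqrt_mult)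
    moreover have "real (n - 1) * (4 * (\<kappa> * X) / real z) \<le> 2 * (\<kappa> * X)"
    proof -
      have "2 * real (n - 1) \<le> real z" using zn by linarith
      hence "2 * real (n - 1) * (2 * (\<kappa> * X)) \<le> real z * (2 * (\<kappa> * X))"
        using \<kappa>0 Xpos by (intro mult_right_mono) auto
      thus ?thesis using zn n2 by (simp add: field_simps)
    qed
    moreover have "1 + real (n - 1) * sqrt C * sqrt X \<le> \<kappa> * X" using X0[OF XX0] .
    ultimately have cardG: "\<kappa> * X \<le> real (card G)" using card by (simp add: distrib_left mult.assoc)
    have "finite B" unfolding B_def
      using card_residue_class_ge(1)[of "u * X" "w * X" "int W" b0] uw Xpos W0 by simp
    hence "finite G" by (simp add: G_def)
    moreover have "irreducible (P T b) \<and> num_real_roots (P T b) = n - 2 * s \<and>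
        squarefree (discriminant (P T b)) \<and> (\<forall>p\<in>S. \<not> int p dvd discriminant (P T b)) \<and>
        real_of_int \<bar>discriminant (P T b)\<bar> \<le> (C * X) ^ (n - 1)" if bG: "b \<in> G" for b
    proof (intro conjI ballI)
      have b: "b \<in> B" and sq: "squarefree (\<Prod>j\<in>?I. F j b)" using bG by (auto simp: G_def F_def)
      have "discriminant (P T b) = disc_sign * (\<Prod>j\<in>?I. F j b)"
        unfolding F_def by (rule discriminant_P) (use T0 in simp)
      moreover have "disc_sign = 1 \<or> disc_sign = -1" by (simp add: disc_sign_def minus_one_power_iff)
      ultimately have disc: "discriminant (P T b) = (\<Prod>j\<in>?I. F j b) \<or> discriminant (P T b) = - (\<Prod>j\<in>?I. F j b)"
        by auto
      show "irreducible (P T b)"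
      proof (rule irreducible_P[OF qT ql])
        fix l assume l: "prime l" "l dvd q"
        have "l \<le> z" using dvd_imp_le[OF l(2)] q2 zq by linarith
        from cong_trans[OF BU[OF b l(1) this] U(2)[OF l]] g[OF l(1)]
        show "residue_primroot l (g l) \<and> [b = - int (g l)] (mod int l)" by blast
      qed
      show "num_real_roots (P T b) = n - 2 * s"
        by (rule num_real_roots_P[OF T0 s]) (use win[OF Bwin[OF b]] in auto)
      show "squarefree (discriminant (P T b))" using disc sq by (auto simp: squarefree_def)
      fix p assume p: "p \<in> S"
      have "\<not> int p dvd (\<Prod>j\<in>?I. F j b)"
        using Fsmall[OF _ b S(2)[OF p] zS[OF p]] S(2)[OF p] by (subst prime_dvd_prod_iff) auto
      thus "\<not> int p dvd discriminant (P T b)" using disc by auto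
    next
      have b: "b \<in> B" using bG by (auto simp: G_def)
      have "\<bar>discriminant (P T b)\<bar> = \<bar>\<Prod>j\<in>?I. F j b\<bar>"
        using discriminant_P[of T b] T0 by (simp add: F_def disc_sign_def abs_mult power_abs)
      hence "real_of_int \<bar>discriminant (P T b)\<bar> = (\<Prod>j\<in>?I. real_of_int \<bar>F j b\<bar>)"
        by (simp add: abs_prod)
      also have "\<dots> \<le> (\<Prod>j\<in>?I. C * X)" using Fle b by (intro prod_mono) auto
      finally show "real_of_int \<bar>discriminant (P T b)\<bar> \<le> (C * X) ^ (n - 1)" by simp
    qed
    ultimately show ?thesis using cardG unfolding X_def T_def by blast
  qed
  show ?thesis
    by (rule exI[of _ q], rule exI[of _ C], rule exI[of _ \<kappa>], rule exI[of _ k0])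
      (use q2 C0 \<kappa>0 main in blast)
qed

end

section \<open>Distinct discriminants and the final count\<close>

context seed
begin

text \<open>Up to a sign independent of b, the discriminant is a polynomial in b of degree n - 1
  with leading coefficient the product of the \<open>a j\<close>, and n - 1 is positive.\<close>

lemma discriminant_fibre:
  assumes T: "T \<noteq> 0"
  shows "finite {b. discriminant (P T b) = D}" and "card {b. discriminant (P T b) = D} \<le> n - 1"
proof -
  define p where "p = (\<Prod>j\<in>{1..<n}. [:T ^ n * v j, a j:])"
  have "[:T ^ n * v j, a j:] \<noteq> 0" for j using a_pos[of j] by simp
  hence deg: "degree p = n - 1" unfolding p_def
    using a_pos by (subst degree_prod_eq_sum_degree) (auto simp: less_imp_neq[symmetric])
  have "disc_sign = 1 \<or> disc_sign = -1" by (simp add: disc_sign_def minus_one_power_iff)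
  hence "{b. discriminant (P T b) = D} = {b. poly (p - [:disc_sign * D:]) b = 0}"
    by (auto simp: discriminant_P[OF T] p_def poly_prod algebra_simps)
  moreover have "degree (p - [:disc_sign * D:]) = n - 1"
    unfolding diff_conv_add_uminus using deg n2 by (subst degree_add_eq_left) auto
  moreover from this have "p - [:disc_sign * D:] \<noteq> 0" using n2 by force
  ultimately show "finite {b. discriminant (P T b) = D}" "card {b. discriminant (P T b) = D} \<le> n - 1"
    using card_poly_roots_bound[of "p - [:disc_sign * D:]"] poly_roots_finite[of "p - [:disc_sign * D:]"] by simp_all
qed

lemma card_le_card_discriminants:
  assumes T: "T \<noteq> 0" and G: "finite G"
  shows "card G \<le> (n - 1) * card ((\<lambda>b. discriminant (P T b)) ` G)"
proof -
  let ?f = "\<lambda>b. discriminant (P T b)"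
  have fib: "card {b\<in>G. ?f b = D} \<le> n - 1" if "D \<in> ?f ` G" for D
  proof -
    have "card {b\<in>G. ?f b = D} \<le> card {b. ?f b = D}"
      by (rule card_mono) (use discriminant_fibre(1)[OF T] in auto)
    thus ?thesis using discriminant_fibre(2)[OF T, of D] by linarith
  qed
  have "G = (\<Union>D\<in>?f ` G. {b\<in>G. ?f b = D})" by auto
  hence "card G \<le> (\<Sum>D\<in>?f ` G. card {b\<in>G. ?f b = D})"
    using card_UN_le[of "?f ` G" "\<lambda>D. {b\<in>G. ?f b = D}"] G by simp
  also have "\<dots> \<le> card (?f ` G) * (n - 1)" using sum_bounded_above[of "?f ` G", OF fib] by simp
  finally show ?thesis by (simp add: mult.commute)
qed

end

text \<open>The scales C B^k grow geometrically, so some k satisfies C B^k \<le> N^(1/m) < C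
  B^(k+1). Rounding down to it costs only a factor B in the constant.\<close>

lemma powr_lower_bound_of_geometric:
  fixes f :: "real \<Rightarrow> real"
  assumes B: "B > 1" and C: "C > 0" and \<kappa>: "\<kappa> > 0" and m: "m > 0"
    and f: "\<And>k N. k \<ge> k0 \<Longrightarrow> N \<ge> (C * B ^ k) ^ m \<Longrightarrow> f N \<ge> \<kappa> * B ^ k"
  shows "\<exists>c>0. \<forall>\<^sub>F N in at_top. f N \<ge> c * N powr (1 / real m)"
proof (intro exI conjI)
  show "\<kappa> / (C * B) > 0" using assms by simp
  have "\<forall>\<^sub>F N in at_top. N \<ge> max 1 ((C * B ^ k0) ^ m)" by (rule eventually_ge_at_top)
  thus "\<forall>\<^sub>F N in at_top. f N \<ge> \<kappa> / (C * B) * N powr (1 / real m)"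
  proof eventually_elim
    case (elim N)
    define M where "M = N powr (1 / real m)"
    have M0: "M > 0" using elim by (simp add: M_def)
    have Mm: "M ^ m = N" using elim m by (simp add: M_def powr_powr flip: powr_realpow)
    have "(C * B ^ k0) ^ m \<le> M ^ m" using elim Mm by simp
    hence Mk0: "C * B ^ k0 \<le> M" using m M0 power_mono_iff[of "C * B ^ k0" M m] C B by simp
    obtain K0 where "M / C < B ^ K0" using real_arch_pow[OF B] by blast
    hence "M < C * B ^ K0" using C by (simp add: field_simps)
    then obtain K where K: "M < C * B ^ K" and minK: "\<And>k. k < K \<Longrightarrow> \<not> M < C * B ^ k"
      using exists_least_iff[of "\<lambda>k. M < C * B ^ k"] by blast
    \<comment> \<open>This makes the predecessor of \<open>K\<close> both natural and at least
      \<open>k0\<close>, so \<open>f\<close> applies to it.\<close>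
    have "k0 < K"
    proof (rule ccontr)
      assume "\<not> k0 < K"
      hence "B ^ K \<le> B ^ k0" using B by (intro power_increasing) auto
      hence "C * B ^ K \<le> C * B ^ k0" using C by simp
      thus False using Mk0 K by linarith
    qed
    then obtain k where k: "K = Suc k" "k \<ge> k0" by (cases K) auto
    have "C * B ^ k \<le> M" using minK[of k] k by simp
    hence "(C * B ^ k) ^ m \<le> N" unfolding Mm[symmetric] using C B by (intro power_mono) auto
    from f[OF k(2) this] have "\<kappa> * B ^ k \<le> f N" .
    moreover have "\<kappa> / (C * B) * M \<le> \<kappa> / (C * B) * (C * B ^ K)"
      using K \<kappa> C B by (intro mult_left_mono) auto
    moreover have "\<kappa> / (C * B) * (C * B ^ K) = \<kappa> * B ^ k" using C B k by simp
    ultimately show ?case by (simp add: M_def)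
  qed
qed

theorem theorem1p1:
  fixes n r s :: nat and S :: "nat set"
  assumes "n \<ge> 2" and "r + 2 * s = n"
    and "finite S" and "\<forall>p\<in>S. prime p"
  defines "good \<equiv> {P :: int poly. lead_coeff P = 1 \<and> degree P = n \<and> irreducible P \<and>
              num_real_roots P = r \<and> squarefree (discriminant P) \<and>
              (\<forall>p\<in>S. \<not> int p dvd discriminant P)}"
  shows "infinite good \<and>
         (\<exists>c > 0. \<forall>\<^sub>F (N :: real) in at_top.
             real (card {D :: int. real_of_int \<bar>D\<bar> \<le> N \<and> (\<exists>P\<in>good. discriminant P = D)})
               \<ge> c * N powr (1 / (real n - 1)))"
proof -
  obtain Q c \<gamma> where "seed n Q c \<gamma>"
    using seed_polynomial_exists[OF assms(1)] assms(1) unfolding seed_def by fastforce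
  then interpret seed n Q c \<gamma> .
  have s: "2 * s \<le> n" and r: "n - 2 * s = r" using assms(2) by auto
  obtain q :: nat and C \<kappa> k0 where q: "q \<ge> 2" and C: "C > 0" and \<kappa>: "\<kappa> > 0" and main: "\<And>k. k \<ge> k0 \<Longrightarrow>
      \<exists>G. finite G \<and> \<kappa> * real (q ^ n) ^ k \<le> real (card G) \<and>
      (\<forall>b\<in>G. irreducible (P (int q ^ k) b) \<and> num_real_roots (P (int q ^ k) b) = n - 2 * s \<and>
        squarefree (discriminant (P (int q ^ k) b)) \<and>
        (\<forall>p\<in>S. \<not> int p dvd discriminant (P (int q ^ k) b)) \<and>
        real_of_int \<bar>discriminant (P (int q ^ k) b)\<bar> \<le> (C * real (q ^ n) ^ k) ^ (n - 1))"
    using many_good_polynomials[OF s assms(3)] assms(4) by blast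
  define m where "m = n - 1"
  have m: "m > 0" "real m = real n - 1" using assms(1) by (auto simp: m_def)
  define B where "B = real (q ^ n)"
  have "2 \<le> q ^ n" using q n2 self_le_power[of q n] by linarith
  hence B: "B > 1" unfolding B_def by linarith
  define discs where "discs = (\<lambda>N::real. {D :: int. real_of_int \<bar>D\<bar> \<le> N \<and> (\<exists>P\<in>good. discriminant P = D)})"
  have fin: "finite (discs N)" for N
    by (rule finite_subset[of _ "{-\<lceil>N\<rceil>..\<lceil>N\<rceil>}"]) (auto simp: discs_def abs_le_iff le_ceiling_iff, linarith+)
  \<comment> \<open>The division by \<open>real m\<close> accounts for at most n - 1 values of b
    sharing a discriminant.\<close>
  have lower: "\<kappa> / real m * B ^ k \<le> real (card (discs N))" if k: "k \<ge> k0" and N: "(C * B ^ k) ^ m \<le> N" for k N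
  proof -
    obtain G where G: "finite G" "\<kappa> * B ^ k \<le> real (card G)" and Gb: "\<And>b. b \<in> G \<Longrightarrow>
        irreducible (P (int q ^ k) b) \<and> num_real_roots (P (int q ^ k) b) = n - 2 * s \<and>
        squarefree (discriminant (P (int q ^ k) b)) \<and>
        (\<forall>p\<in>S. \<not> int p dvd discriminant (P (int q ^ k) b)) \<and>
        real_of_int \<bar>discriminant (P (int q ^ k) b)\<bar> \<le> (C * B ^ k) ^ m"
      using main[OF k] unfolding B_def m_def by blast
    have "(\<lambda>b. discriminant (P (int q ^ k) b)) ` G \<subseteq> discs N"
    proof (rule image_subsetI)
      fix b assume b: "b \<in> G"
      have "P (int q ^ k) b \<in> good" unfolding good_def using Gb[OF b] r degree_P lead_coeff_P by blast
      moreover have "real_of_int \<bar>discriminant (P (int q ^ k) b)\<bar> \<le> N" using Gb[OF b] N by linarith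
      ultimately show "discriminant (P (int q ^ k) b) \<in> discs N" unfolding discs_def by blast
    qed
    hence "card ((\<lambda>b. discriminant (P (int q ^ k) b)) ` G) \<le> card (discs N)" by (rule card_mono[OF fin])
    moreover have "card G \<le> m * card ((\<lambda>b. discriminant (P (int q ^ k) b)) ` G)"
      unfolding m_def by (rule card_le_card_discriminants) (use q G in auto)
    ultimately have "card G \<le> m * card (discs N)" by (meson le_trans mult_le_mono2)
    hence "real (card G) \<le> real m * real (card (discs N))" by (simp only: of_nat_le_iff flip: of_nat_mult)
    hence "\<kappa> * B ^ k \<le> real m * real (card (discs N))" using G(2) by linarith
    thus ?thesis using m(1) by (simp add: field_simps)
  qed
  \<comment> \<open>Finitely many polynomials would have a bounded number of discriminants, whereas
    \<open>lower\<close> grows like B^k.\<close>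
  have "infinite good"
  proof
    assume fg: "finite good"
    obtain k1 where k1: "real (card (discriminant ` good)) / (\<kappa> / real m) < B ^ k1" using real_arch_pow[OF B] by blast
    have "B ^ k1 \<le> B ^ (max k0 k1)" using B by (intro power_increasing) auto
    hence "real (card (discriminant ` good)) / (\<kappa> / real m) < B ^ (max k0 k1)" using k1 by linarith
    hence "real (card (discriminant ` good)) < \<kappa> / real m * B ^ (max k0 k1)"
      using \<kappa> m(1) by (simp add: field_simps)
    also have "\<dots> \<le> real (card (discs ((C * B ^ (max k0 k1)) ^ m)))" by (rule lower) auto
    also have "card (discs ((C * B ^ (max k0 k1)) ^ m)) \<le> card (discriminant ` good)"
      by (rule card_mono) (use fg in \<open>auto simp: discs_def\<close>)
    finally show False by simp
  qed
  moreover have "\<exists>c>0. \<forall>\<^sub>F N in at_top. real (card (discs N)) \<ge> c * N powr (1 / real m)"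
    by (rule powr_lower_bound_of_geometric[OF B C _ m(1) lower]) (use \<kappa> m in auto)
  ultimately show ?thesis unfolding discs_def m(2) by blast
qed

end
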